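(* Let $n$ and $d$ be integers with $n \geq 2d+2$ and $d \geq 1$, and let $G = C_n(d+1,d+2,\ldots,\lfloor \frac{n}{2} \rfloor)$. The following are equivalent: (i) $G$ is Buchsbaum; (ii) $G$ is well-covered; (iii) $n > 3d$ or $n = 2d+2$. Furthermore, for each of the three properties "vertex decomposable", "shellable", "Cohen-Macaulay", the graph $G$ has that property if and only if either $n = 2d+2$ and $d \geq 1$, or $d = 1$ and $n > 3$.
   Context: For an integer $n\ge 1$ and a set $S\subseteq\{1,\ldots,\lfloor n/2\rfloor\}$, the circulant graph $C_n(S)$ has vertex set $\{0,1,\ldots,n-1\}$, and distinct $a,b$ are adjacent if and only if $|a-b|\in S$ or $n-|a-b|\in S$; write $C_n(a_1,\ldots,a_t)$ for $C_n(\{a_1,\ldots,a_t\})$. A finite simple graph is well-covered if all its minimal vertex covers (equivalently, all its inclusion-maximal independent sets) have the same cardinality. The independence complex $\mathrm{Ind}(G)$ is the simplicial complex of all independent sets of $G$; it is pure (all facets of the same dimension) if and only if $G$ is well-covered. For a simplicial complex $\Delta$ and a face $F$: $\mathrm{link}_\Delta(F)=\{H\in\Delta : F\cap H=\emptyset,\ F\cup H\in\Delta\}$ and $\mathrm{del}_\Delta(F)=\{H\in\Delta : F\not\subseteq H\}$; for a vertex $x$ write $x$ instead of $\{x\}$. Also $\dim F=|F|-1$. Fix a field $k$. A pure simplicial complex $\Delta$ is: - vertex decomposable if $\Delta$ is a simplex (its whole vertex set is its unique facet), or there is a vertex $x$ such that $\mathrm{link}_\Delta(x)$ and $\mathrm{del}_\Delta(x)$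 are (pure and) vertex decomposable; - shellable if its facets can be ordered $F_1,\ldots,F_t$ so that for all $1\le j<i\le t$ there are $x\in F_i\setminus F_j$ and $l\in\{1,\ldots,i-1\}$ with $F_i\setminus F_l=\{x\}$; - Cohen-Macaulay if for all $F\in\Delta$, $\tilde H_i(\mathrm{link}_\Delta(F),k)=0$ for all $i<\dim \mathrm{link}_\Delta(F)$ (reduced simplicial homology); - Buchsbaum if $\mathrm{link}_\Delta(x)$ is Cohen-Macaulay for every vertex $x$. A graph $G$ is said to have one of these properties if $\mathrm{Ind}(G)$ is pure and has it. *)

theory Defs
  imports "HOL-Library.Ramsey" "HOL-Algebra.Elementary_Groups"
begin

section \<open>Graphs\<close>

text \<open>A simple graph is a pair of a vertex set and a set of two-element edges,
  the edge representation used by \<^const>\<open>indep\<close>.\<close>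

type_synonym 'a graph = "'a set \<times> 'a set set"

definition circulant_graph :: "nat \<Rightarrow> nat set \<Rightarrow> nat graph" where
  "circulant_graph n S =
     ({0..<n},
      {{a, b} | a b. a < n \<and> b < n \<and> a \<noteq> b \<and>
         (nat \<bar>int a - int b\<bar> \<in> S \<or> n - nat \<bar>int a - int b\<bar> \<in> S)})"

definition vertex_cover :: "'a graph \<Rightarrow> 'a set \<Rightarrow> bool" where
  "vertex_cover G C \<longleftrightarrow> C \<subseteq> fst G \<and> (\<forall>e\<in>snd G. e \<inter> C \<noteq> {})"

definition minimal_vertex_cover :: "'a graph \<Rightarrow> 'a set \<Rightarrow> bool" where
  "minimal_vertex_cover G C \<longleftrightarrow>
     vertex_cover G C \<and> (\<forall>D. D \<subset> C \<longrightarrow> \<not> vertex_cover G D)"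

definition well_covered :: "'a graph \<Rightarrow> bool" where
  "well_covered G \<longleftrightarrow>
     (\<forall>C D. minimal_vertex_cover G C \<longrightarrow> minimal_vertex_cover G D \<longrightarrow> card C = card D)"

definition independence_complex :: "'a graph \<Rightarrow> 'a set set" where
  "independence_complex G = {F. F \<subseteq> fst G \<and> indep F (snd G)}"

section \<open>Simplicial complexes\<close>

text \<open>A finite simplicial complex is represented by its set of faces. The vertices of
  \<open>\<Delta>\<close> are the elements of \<open>\<Union>\<Delta>\<close>, i.e. those \<open>x\<close> for which \<open>{x}\<close> is a face.\<close>

definition simplicial_complex :: "'a set set \<Rightarrow> bool" where
  "simplicial_complex \<Delta> \<longleftrightarrow>
     finite \<Delta> \<and> (\<forall>F\<in>\<Delta>. finite F) \<and> (\<forall>F\<in>\<Delta>. \<forall>H. H \<subseteq> F \<longrightarrow> H \<in> \<Delta>)"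

definition facets :: "'a set set \<Rightarrow> 'a set set" where
  "facets \<Delta> = {F \<in> \<Delta>. \<forall>H\<in>\<Delta>. F \<subseteq> H \<longrightarrow> H = F}"

definition link :: "'a set set \<Rightarrow> 'a set \<Rightarrow> 'a set set" where
  "link \<Delta> F = {H \<in> \<Delta>. F \<inter> H = {} \<and> F \<union> H \<in> \<Delta>}"

definition deletion :: "'a set set \<Rightarrow> 'a set \<Rightarrow> 'a set set" where
  "deletion \<Delta> F = {H \<in> \<Delta>. \<not> F \<subseteq> H}"

definition face_dim :: "'a set \<Rightarrow> int" where
  "face_dim F = int (card F) - 1"

definition complex_dim :: "'a set set \<Rightarrow> int" where
  "complex_dim \<Delta> = Max (face_dim ` \<Delta>)"

definition pure_complex :: "'a set set \<Rightarrow> bool" where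
  "pure_complex \<Delta> \<longleftrightarrow>
     simplicial_complex \<Delta> \<and> (\<forall>F\<in>facets \<Delta>. \<forall>H\<in>facets \<Delta>. face_dim F = face_dim H)"

text \<open>Purity is part of each of the properties below, so a graph has one of them
  iff its independence complex satisfies the corresponding predicate.\<close>

inductive vertex_decomposable :: "'a set set \<Rightarrow> bool" where
  simplex: "pure_complex \<Delta> \<Longrightarrow> facets \<Delta> = {\<Union>\<Delta>} \<Longrightarrow> vertex_decomposable \<Delta>"
| vertex: "pure_complex \<Delta> \<Longrightarrow> x \<in> \<Union>\<Delta> \<Longrightarrow>
    vertex_decomposable (link \<Delta> {x}) \<Longrightarrow> vertex_decomposable (deletion \<Delta> {x}) \<Longrightarrow>
    vertex_decomposable \<Delta>"

definition shellable :: "'a set set \<Rightarrow> bool" where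
  "shellable \<Delta> \<longleftrightarrow> pure_complex \<Delta> \<and>
     (\<exists>Fs. distinct Fs \<and> set Fs = facets \<Delta> \<and>
        (\<forall>i<length Fs. \<forall>j<i. \<exists>x \<in> Fs ! i - Fs ! j. \<exists>l<i. Fs ! i - Fs ! l = {x}))"

section \<open>Reduced simplicial homology over a field\<close>

text \<open>Faces are oriented by the linear order on the vertices, and a chain is given by its
  coefficient function. Degrees are integers; the empty face spans the chains of degree
  \<open>-1\<close>, so \<open>boundary\<close> on degree \<open>0\<close> is the augmentation.\<close>

definition simplicial_chains :: "'a set set \<Rightarrow> int \<Rightarrow> ('a set \<Rightarrow> 'k::field) set" where
  "simplicial_chains \<Delta> i = {c. \<forall>F. c F \<noteq> 0 \<longrightarrow> F \<in> \<Delta> \<and> face_dim F = i}"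

text \<open>Coefficientwise form of
  \<open>\<partial>[v\<^sub>0, \<dots>, v\<^sub>i] = (\<Sum>j\<le>i. (-1)^j [v\<^sub>0, \<dots>, v\<^sub>j\<^sub>-\<^sub>1, v\<^sub>j\<^sub>+\<^sub>1, \<dots>, v\<^sub>i])\<close>
  for \<open>v\<^sub>0 < \<dots> < v\<^sub>i\<close>: the face \<open>H\<close> arises from the faces \<open>insert v H\<close> by omitting
  \<open>v\<close>, whose position there is the number of elements of \<open>H\<close> below \<open>v\<close>.\<close>

definition boundary :: "'a::linorder set set \<Rightarrow> ('a set \<Rightarrow> 'k::field) \<Rightarrow> 'a set \<Rightarrow> 'k" where
  "boundary \<Delta> c H =
     (\<Sum>v | v \<notin> H \<and> insert v H \<in> \<Delta>. (- 1) ^ card {u \<in> H. u < v} * c (insert v H))"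

definition simplicial_cycles :: "'a::linorder set set \<Rightarrow> int \<Rightarrow> ('a set \<Rightarrow> 'k::field) set" where
  "simplicial_cycles \<Delta> i = {c \<in> simplicial_chains \<Delta> i. boundary \<Delta> c = (\<lambda>_. 0)}"

definition simplicial_boundaries :: "'a::linorder set set \<Rightarrow> int \<Rightarrow> ('a set \<Rightarrow> 'k::field) set" where
  "simplicial_boundaries \<Delta> i = boundary \<Delta> ` simplicial_chains \<Delta> (i + 1)"

definition cycle_group :: "'a::linorder set set \<Rightarrow> int \<Rightarrow> ('a set \<Rightarrow> 'k::field) monoid" where
  "cycle_group \<Delta> i =
     \<lparr>carrier = simplicial_cycles \<Delta> i, monoid.mult = (\<lambda>c c' F. c F + c' F), one = (\<lambda>_. 0)\<rparr>"

text \<open>Only the additive group of the \<open>k\<close>-vector space is recorded, which is all that its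
  vanishing depends on.\<close>

definition reduced_homology ::
    "'k itself \<Rightarrow> 'a::linorder set set \<Rightarrow> int \<Rightarrow> ('a set \<Rightarrow> 'k::field) set monoid" where
  "reduced_homology k \<Delta> i = cycle_group \<Delta> i Mod simplicial_boundaries \<Delta> i"

definition cohen_macaulay :: "'k::field itself \<Rightarrow> 'a::linorder set set \<Rightarrow> bool" where
  "cohen_macaulay k \<Delta> \<longleftrightarrow> pure_complex \<Delta> \<and>
     (\<forall>F\<in>\<Delta>. \<forall>i < complex_dim (link \<Delta> F). trivial_group (reduced_homology k (link \<Delta> F) i))"

definition buchsbaum :: "'k::field itself \<Rightarrow> 'a::linorder set set \<Rightarrow> bool" where
  "buchsbaum k \<Delta> \<longleftrightarrow> pure_complex \<Delta> \<and> (\<forall>x\<in>\<Union>\<Delta>. cohen_macaulay k (link \<Delta> {x}))"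

end

theory Submission
  imports Defs
begin

text \<open>
  A set of vertices of \<open>C\<^sub>n(d+1, \<dots>, \<lfloor>n/2\<rfloor>)\<close> is independent iff its elements are pairwise at
  cyclic distance at most \<open>d\<close>, so the independence complex is the clique complex of the
  \<open>d\<close>-th power of the \<open>n\<close>-cycle (\<open>cyclic_cliques\<close>). Its shape depends on \<open>n\<close> as follows.

  For \<open>n = 2d + 2\<close> only antipodal vertices are too far apart, and the complex is the boundary
  of a cross-polytope, which is vertex decomposable.

  For \<open>2d + 2 < n \<le> 3d\<close> a clique may wind around the cycle. The \<open>d + 1\<close> consecutive vertices
  \<open>0, \<dots>, d\<close> form a facet, and so do \<open>0, \<dots>, 3d - n, d, 2d\<close>, which are fewer; hence the complex is
  not pure (\<open>cyclic_cliques_not_pure\<close>), which excludes all five properties.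

  For \<open>n > 3d\<close> no clique winds around, and the facets are exactly the \<open>n\<close> arcs of \<open>d + 1\<close>
  consecutive vertices. The arcs through a fixed vertex, taken in cyclic order, shell its link,
  so the complex is Buchsbaum. For \<open>d = 1\<close> it is a cycle of length at least 4, which is vertex
  decomposable. For \<open>d \<ge> 2\<close> the loop \<open>0, 1, \<dots>, n - 1, 0\<close> is a \<open>1\<close>-cycle which does not bound:
  the cocycle that counts passages from \<open>n - 1\<close> to \<open>0\<close> does not vanish on it. As the
  dimension \<open>d\<close> exceeds 1, the complex is not Cohen-Macaulay.

  The remaining implications hold for every complex: vertex decomposable implies shellable,
  shellable implies Cohen-Macaulay, and Cohen-Macaulay implies Buchsbaum. The homological step is
  \<open>attach_face_acyclic\<close>: a shelling adds one interval \<open>[R, F]\<close> of faces at a time, and coning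
  over a vertex of \<open>F - R\<close> pushes any cycle off the new faces.
\<close>

section \<open>The boundary operator and its cone homotopy\<close>

text \<open>The coefficient of \<open>H\<close> in the boundary of the oriented face \<open>insert v H\<close>.\<close>

definition incidence_sign :: "'a::linorder set \<Rightarrow> 'a \<Rightarrow> 'k::field" where
  "incidence_sign H v = (- 1) ^ card {u \<in> H. u < v}"

text \<open>Summing over all of a fixed vertex set \<open>V\<close> instead of the cofaces in \<open>\<Delta>\<close> makes the operator
  independent of the complex, so that chains of different subcomplexes can be compared. On chains of
  \<open>\<Delta>\<close> both operators agree, because the additional summands vanish.\<close>

definition ambient_boundary :: "'a::linorder set \<Rightarrow> ('a set \<Rightarrow> 'k::field) \<Rightarrow> 'a set \<Rightarrow> 'k" where
  "ambient_boundary V c H = (\<Sum>v\<in>V - H. incidence_sign H v * c (insert v H))"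

text \<open>The chain \<open>x * c\<close>, with the terms of \<open>c\<close> that already contain \<open>x\<close> discarded. The sign is the one
  with which \<open>H - {x}\<close> occurs in the boundary of \<open>H\<close>.\<close>

definition cone :: "'a::linorder \<Rightarrow> ('a set \<Rightarrow> 'k::field) \<Rightarrow> 'a set \<Rightarrow> 'k" where
  "cone x c H = (if x \<in> H then incidence_sign (H - {x}) x * c (H - {x}) else 0)"

lemma incidence_sign_square [simp]: "incidence_sign H v * incidence_sign H v = (1::'k::field)"
  by (simp add: incidence_sign_def flip: power_mult_distrib)

lemma incidence_sign_square_left [simp]: "incidence_sign H v * (incidence_sign H v * z) = (z::'k::field)"
  by (metis incidence_sign_square mult.assoc mult_1)

lemma incidence_sign_insert:
  assumes "finite H" "v \<notin> H"
  shows "incidence_sign (insert v H) w =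
    (if v < w then - incidence_sign H w else (incidence_sign H w :: 'k::field))"
proof -
  have "{u \<in> insert v H. u < w} = (if v < w then insert v {u \<in> H. u < w} else {u \<in> H. u < w})"
    by auto
  then show ?thesis using assms by (simp add: incidence_sign_def)
qed

lemma incidence_sign_swap:
  assumes "finite H" "v \<notin> H" "w \<notin> H" "v \<noteq> w"
  shows "incidence_sign (insert v H) w * incidence_sign H v =
    - (incidence_sign (insert w H) v * incidence_sign H w :: 'k::field)"
  using assms less_linear[of v w] by (auto simp: incidence_sign_insert)

text \<open>The usual cancellation: omitting \<open>v\<close> and then \<open>w\<close> has the opposite sign of omitting them in the
  other order. The pairs are split into \<open>v < w\<close> and \<open>w < v\<close>, since in characteristic 2
  a sum that equals its own negative need not vanish.\<close>

lemma ambient_boundary_ambient_boundary: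
  assumes "finite V" "H \<subseteq> V"
  shows "ambient_boundary V (ambient_boundary V c) H = (0::'k::field)"
proof -
  let ?f = "\<lambda>v w. incidence_sign H v * (incidence_sign (insert v H) w * c (insert w (insert v H)))"
  let ?P = "{(v, w). v \<in> V - H \<and> w \<in> V - H \<and> v < w}"
  let ?Q = "{(v, w). v \<in> V - H \<and> w \<in> V - H \<and> w < v}"
  have fH: "finite H" using assms finite_subset by blast
  have fin: "finite ?P" "finite ?Q"
    by (rule finite_subset[of _ "V \<times> V"]; use assms in auto)+
  have anti: "?f w v = - ?f v w" if "v \<in> V - H" "w \<in> V - H" "v \<noteq> w" for v w
  proof -
    have "incidence_sign H v * incidence_sign (insert v H) w
        = - (incidence_sign H w * incidence_sign (insert w H) v :: 'k)"
      using incidence_sign_swap[of H v w] that fH by (simp add: mult.commute)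
    then show ?thesis
      unfolding insert_commute[of v w H] mult.assoc[symmetric] by simp
  qed
  have "ambient_boundary V (ambient_boundary V c) H = (\<Sum>v\<in>V - H. \<Sum>w\<in>V - insert v H. ?f v w)"
    by (simp add: ambient_boundary_def sum_distrib_left)
  also have "\<dots> = (\<Sum>(v, w)\<in>(SIGMA v:V - H. V - insert v H). ?f v w)"
    using assms by (subst sum.Sigma) auto
  also have "(SIGMA v:V - H. V - insert v H) = ?P \<union> ?Q"
    by auto
  also have "(\<Sum>(v, w)\<in>?P \<union> ?Q. ?f v w) = (\<Sum>(v, w)\<in>?P. ?f v w) + (\<Sum>(v, w)\<in>?Q. ?f v w)"
    by (rule sum.union_disjoint[OF fin]) auto
  also have "(\<Sum>(v, w)\<in>?Q. ?f v w) = (\<Sum>(v, w)\<in>?P. ?f w v)"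
    by (rule sum.reindex_bij_witness[of _ prod.swap prod.swap]) auto
  also have "\<dots> = (\<Sum>(v, w)\<in>?P. - ?f v w)"
    by (rule sum.cong[OF refl]) (use anti in \<open>auto simp del: mult_minus_left mult_minus_right\<close>)
  also have "\<dots> = - (\<Sum>(v, w)\<in>?P. ?f v w)"
    by (simp add: sum_negf split_beta)
  finally show ?thesis by simp
qed

text \<open>The full simplex on \<open>V\<close> is contractible to \<open>x\<close>, and \<open>cone x\<close> is the chain homotopy between the
  identity and zero. The summands with \<open>v \<noteq> x\<close> cancel by the anticommutation of signs; the
  summand \<open>v = x\<close> leaves \<open>c H\<close>.\<close>

lemma cone_homotopy:
  assumes "finite V" "H \<subseteq> V" "x \<in> V"
  shows "ambient_boundary V (cone x c) H + cone x (ambient_boundary V c) H = (c H :: 'k::field)"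
proof (cases "x \<in> H")
  case False
  have "ambient_boundary V (cone x c) H = (\<Sum>v\<in>V - H. if v = x then c H else 0)"
    unfolding ambient_boundary_def
    by (rule sum.cong[OF refl]) (use False in \<open>auto simp: cone_def\<close>)
  also have "\<dots> = c H" using assms False by (simp add: sum.delta)
  finally show ?thesis using False by (simp add: cone_def)
next
  case True
  define H' where "H' = H - {x}"
  have H: "H = insert x H'" "x \<notin> H'" using True H'_def by auto
  have fin: "finite H'" using assms finite_subset H'_def by (metis finite_Diff)
  have summand: "incidence_sign H v * cone x c (insert v H)
      = - (incidence_sign H' x * (incidence_sign H' v * c (insert v H')))" if "v \<in> V - H" for v
  proof -
    have "insert v H - {x} = insert v H'" using that H by auto
    then have "incidence_sign H v * cone x c (insert v H)
      = (incidence_sign (insert v H') x * incidence_sign H v) * c (insert v H')"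
      using H by (simp add: cone_def mult.commute mult.left_commute)
    moreover have "incidence_sign (insert v H') x * incidence_sign H v
      = - (incidence_sign H' x * incidence_sign H' v :: 'k)"
    proof -
      have "v \<noteq> x" "v \<notin> H'" using that H by auto
      then show ?thesis using fin H less_linear[of v x]
        by (auto simp: incidence_sign_insert)
    qed
    ultimately show ?thesis by (simp add: mult.assoc)
  qed
  have split: "V - H' = insert x (V - H)" using assms H by auto
  have "ambient_boundary V c H' = incidence_sign H' x * c H
      + (\<Sum>v\<in>V - H. incidence_sign H' v * c (insert v H'))"
    unfolding ambient_boundary_def split using assms True H by simp
  then have "cone x (ambient_boundary V c) H
      = c H + (\<Sum>v\<in>V - H. incidence_sign H' x * (incidence_sign H' v * c (insert v H')))"
    using True by (simp add: cone_def flip: H'_def) (simp add: distrib_left sum_distrib_left)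
  moreover have "ambient_boundary V (cone x c) H
      = - (\<Sum>v\<in>V - H. incidence_sign H' x * (incidence_sign H' v * c (insert v H')))"
    unfolding ambient_boundary_def using summand by (simp add: sum_negf)
  ultimately show ?thesis by simp
qed

lemma simplicial_chainsD:
  "c \<in> simplicial_chains \<Delta> i \<Longrightarrow> c F \<noteq> 0 \<Longrightarrow> F \<in> \<Delta> \<and> face_dim F = i"
  by (simp add: simplicial_chains_def)

lemma simplicial_complex_finite_vertices: "simplicial_complex \<Delta> \<Longrightarrow> finite (\<Union>\<Delta>)"
  by (auto simp: simplicial_complex_def)

lemma boundary_eq_ambient_boundary:
  assumes "finite V" "\<Union>\<Delta> \<subseteq> V" "c \<in> simplicial_chains \<Delta> i"
  shows "boundary \<Delta> c = ambient_boundary V c"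
proof
  fix H
  show "boundary \<Delta> c H = ambient_boundary V c H"
    unfolding boundary_def ambient_boundary_def incidence_sign_def
  proof (rule sum.mono_neutral_left)
    show "\<forall>v\<in>V - H - {v. v \<notin> H \<and> insert v H \<in> \<Delta>}. (- 1) ^ card {u \<in> H. u < v} * c (insert v H) = 0"
      using assms(3) by (fastforce simp: simplicial_chains_def)
  qed (use assms in auto)
qed

lemma simplicial_chains_mono: "\<Delta> \<subseteq> \<Gamma> \<Longrightarrow> simplicial_chains \<Delta> i \<subseteq> simplicial_chains \<Gamma> i"
  by (auto simp: simplicial_chains_def)

lemma boundary_mono:
  assumes "simplicial_complex \<Gamma>" "\<Delta> \<subseteq> \<Gamma>" "c \<in> simplicial_chains \<Delta> i"
  shows "boundary \<Delta> c = boundary \<Gamma> c"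
proof -
  have "c \<in> simplicial_chains \<Gamma> i" using assms simplicial_chains_mono by blast
  then show ?thesis
    using assms boundary_eq_ambient_boundary[of "\<Union>\<Gamma>" \<Gamma> c i] boundary_eq_ambient_boundary[of "\<Union>\<Gamma>" \<Delta> c i]
    by (simp add: simplicial_complex_finite_vertices Union_mono)
qed

lemma boundary_in_simplicial_chains:
  assumes "simplicial_complex \<Delta>" "c \<in> simplicial_chains \<Delta> (i + 1)"
  shows "boundary \<Delta> c \<in> simplicial_chains \<Delta> i"
  unfolding simplicial_chains_def
proof safe
  fix H assume "boundary \<Delta> c H \<noteq> 0"
  then obtain v where v: "v \<notin> H" "insert v H \<in> \<Delta>" "c (insert v H) \<noteq> 0"
    unfolding boundary_def by (elim sum.not_neutral_contains_not_neutral) auto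
  then show "H \<in> \<Delta>" using assms(1) unfolding simplicial_complex_def by (meson subset_insertI)
  have "finite H" using v assms(1) unfolding simplicial_complex_def by (meson finite_insert)
  moreover have "face_dim (insert v H) = i + 1" using simplicial_chainsD[OF assms(2) v(3)] by simp
  ultimately show "face_dim H = i" using v by (simp add: face_dim_def)
qed

lemma boundary_boundary:
  assumes "simplicial_complex \<Delta>" "c \<in> simplicial_chains \<Delta> (i + 1)"
  shows "boundary \<Delta> (boundary \<Delta> c) = (\<lambda>_. 0)"
proof
  fix H
  let ?V = "\<Union>\<Delta>"
  note fin = simplicial_complex_finite_vertices[OF assms(1)]
  note b = boundary_in_simplicial_chains[OF assms]
  show "boundary \<Delta> (boundary \<Delta> c) H = 0"
  proof (cases "H \<subseteq> ?V")
    case True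
    then show ?thesis
      using ambient_boundary_ambient_boundary[OF fin True, of c]
        boundary_eq_ambient_boundary[OF fin order.refl b]
        boundary_eq_ambient_boundary[OF fin order.refl assms(2)] by simp
  next
    case False
    then have none: "{v. v \<notin> H \<and> insert v H \<in> \<Delta>} = {}" by blast
    show ?thesis by (subst boundary_def) (simp only: none sum.empty)
  qed
qed

lemma boundaries_subset_cycles:
  "simplicial_complex \<Delta> \<Longrightarrow> simplicial_boundaries \<Delta> i \<subseteq> simplicial_cycles \<Delta> i"
  by (auto simp: simplicial_boundaries_def simplicial_cycles_def boundary_in_simplicial_chains
      boundary_boundary)

lemma boundary_zero [simp]: "boundary \<Delta> (\<lambda>_. 0) = (\<lambda>_. 0)"
  by (rule ext) (simp add: boundary_def)

lemma boundary_add: "boundary \<Delta> (\<lambda>F. c F + c' F) = (\<lambda>H. boundary \<Delta> c H + boundary \<Delta> c' H)"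
  by (rule ext) (simp add: boundary_def distrib_left sum.distrib)

lemma boundary_diff: "boundary \<Delta> (\<lambda>F. c F - c' F) = (\<lambda>H. boundary \<Delta> c H - boundary \<Delta> c' H)"
  by (rule ext) (simp add: boundary_def right_diff_distrib sum_subtractf)

lemma simplicial_chains_add:
  "c \<in> simplicial_chains \<Delta> i \<Longrightarrow> c' \<in> simplicial_chains \<Delta> i \<Longrightarrow> (\<lambda>F. c F + c' F) \<in> simplicial_chains \<Delta> i"
proof -
  assume *: "c \<in> simplicial_chains \<Delta> i" "c' \<in> simplicial_chains \<Delta> i"
  have "F \<in> \<Delta> \<and> face_dim F = i" if "c F + c' F \<noteq> 0" for F
    using that simplicial_chainsD[OF *(1), of F] simplicial_chainsD[OF *(2), of F]
    by (cases "c F = 0") simp_all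
  then show ?thesis by (simp add: simplicial_chains_def)
qed

lemma simplicial_chains_diff:
  "c \<in> simplicial_chains \<Delta> i \<Longrightarrow> c' \<in> simplicial_chains \<Delta> i \<Longrightarrow> (\<lambda>F. c F - c' F) \<in> simplicial_chains \<Delta> i"
proof -
  assume *: "c \<in> simplicial_chains \<Delta> i" "c' \<in> simplicial_chains \<Delta> i"
  have "F \<in> \<Delta> \<and> face_dim F = i" if "c F - c' F \<noteq> 0" for F
    using that simplicial_chainsD[OF *(1), of F] simplicial_chainsD[OF *(2), of F]
    by (cases "c F = 0") simp_all
  then show ?thesis by (simp add: simplicial_chains_def)
qed

lemma simplicial_chains_zero: "(\<lambda>_. 0) \<in> simplicial_chains \<Delta> i"
  by (simp add: simplicial_chains_def)

lemma group_cycle_group: "group (cycle_group \<Delta> i :: ('a::linorder set \<Rightarrow> 'k::field) monoid)"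
proof (rule groupI)
  fix c :: "'a set \<Rightarrow> 'k" assume "c \<in> carrier (cycle_group \<Delta> i)"
  then have "(\<lambda>F. 0 - c F) \<in> simplicial_cycles \<Delta> i"
    unfolding simplicial_cycles_def cycle_group_def
    using simplicial_chains_diff[OF simplicial_chains_zero, of c \<Delta> i] boundary_diff[of \<Delta> "\<lambda>_. 0" c]
    by simp
  then show "\<exists>c'\<in>carrier (cycle_group \<Delta> i). c' \<otimes>\<^bsub>cycle_group \<Delta> i\<^esub> c = \<one>\<^bsub>cycle_group \<Delta> i\<^esub>"
    by (intro bexI[of _ "\<lambda>F. 0 - c F"]) (auto simp: cycle_group_def)
qed (auto simp: cycle_group_def simplicial_cycles_def boundary_add simplicial_chains_add
    simplicial_chains_zero add.assoc)

text \<open>The quotient is formed from sets of chains, so that it is a group at all rests on boundaries being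
  cycles.\<close>

lemma trivial_reduced_homology_iff:
  fixes \<Delta> :: "'a::linorder set set"
  assumes "simplicial_complex \<Delta>"
  shows "trivial_group (reduced_homology TYPE('k::field) \<Delta> i) \<longleftrightarrow>
    simplicial_cycles \<Delta> i \<subseteq> (simplicial_boundaries \<Delta> i :: ('a set \<Rightarrow> 'k) set)"
proof
  let ?Z = "cycle_group \<Delta> i :: ('a set \<Rightarrow> 'k) monoid"
  let ?B = "simplicial_boundaries \<Delta> i :: ('a set \<Rightarrow> 'k) set"
  interpret group ?Z by (rule group_cycle_group)
  {
    assume triv: "trivial_group (reduced_homology TYPE('k) \<Delta> i)"
    show "simplicial_cycles \<Delta> i \<subseteq> ?B"
    proof
      fix c :: "'a set \<Rightarrow> 'k" assume "c \<in> simplicial_cycles \<Delta> i"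
      then have "?B #>\<^bsub>?Z\<^esub> c \<in> carrier (?Z Mod ?B)"
        by (auto simp: carrier_FactGroup cycle_group_def)
      then have coset: "?B #>\<^bsub>?Z\<^esub> c = ?B"
        using triv by (simp add: trivial_group_def reduced_homology_def)
      have "(\<lambda>_. 0) \<in> ?B"
        using simplicial_chains_zero[of \<Delta> "i + 1"] by (force simp: simplicial_boundaries_def)
      then have "(\<lambda>_. 0) \<otimes>\<^bsub>?Z\<^esub> c \<in> ?B #>\<^bsub>?Z\<^esub> c" by (auto simp: r_coset_def)
      then show "c \<in> ?B" using coset by (simp add: cycle_group_def)
    qed
  next
    assume "simplicial_cycles \<Delta> i \<subseteq> ?B"
    then have eq: "?B = carrier ?Z"
      using boundaries_subset_cycles[OF assms] by (auto simp: cycle_group_def)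
    have "normal (carrier ?Z) ?Z" by (rule normal_self)
    then have "group (?Z Mod carrier ?Z)" by (rule normal.factorgroup_is_group)
    moreover have "carrier (?Z Mod carrier ?Z) = {carrier ?Z}"
    proof -
      have "carrier ?Z #>\<^bsub>?Z\<^esub> c = carrier ?Z" if "c \<in> carrier ?Z" for c
        using coset_join2[OF that subgroup_self that] .
      then have "(\<lambda>c. carrier ?Z #>\<^bsub>?Z\<^esub> c) ` carrier ?Z = (\<lambda>_. carrier ?Z) ` carrier ?Z"
        by (rule image_cong[OF refl])
      then show ?thesis using one_closed unfolding carrier_FactGroup by (metis image_constant)
    qed
    ultimately show "trivial_group (reduced_homology TYPE('k) \<Delta> i)"
      unfolding trivial_group_def reduced_homology_def eq by simp
  }
qed

section \<open>Attaching a face to an acyclic complex\<close>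

text \<open>If \<open>R \<noteq> F\<close>, take \<open>v\<close> in \<open>F - R\<close> and let \<open>new\<close> be the part of a cycle \<open>c\<close> on the new faces.
  Subtracting the boundary of \<open>cone v new\<close> removes the new faces without \<open>v\<close> by
  \<open>cone_homotopy\<close>. On a new face \<open>H\<close> with \<open>v\<close>, the difference is up to sign the value of the
  boundary of \<open>new\<close> at \<open>H - {v}\<close>; this face contains \<open>R\<close>, so all its cofaces are new, and
  that value is the one of the boundary of \<open>c\<close>, which is 0. Hence \<open>c\<close> is homologous to a cycle
  of the old complex. If \<open>R = F\<close>, the only new face is \<open>F\<close>, which is assumed to lie above degree \<open>i\<close>.\<close>

lemma attach_face_acyclic:
  fixes K K' :: "'a::linorder set set"
  assumes K: "simplicial_complex K" and K': "simplicial_complex K'"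
    and K'_eq: "K' = K \<union> {H. R \<subseteq> H \<and> H \<subseteq> F}" and R: "R \<subseteq> F" "R \<notin> K"
    and top: "R = F \<Longrightarrow> i < face_dim F"
    and IH: "simplicial_cycles K i \<subseteq> (simplicial_boundaries K i :: ('a set \<Rightarrow> 'k::field) set)"
  shows "simplicial_cycles K' i \<subseteq> (simplicial_boundaries K' i :: ('a set \<Rightarrow> 'k) set)"
proof
  fix c :: "'a set \<Rightarrow> 'k" assume c: "c \<in> simplicial_cycles K' i"
  then have chain: "c \<in> simplicial_chains K' i" and bc: "boundary K' c = (\<lambda>_. 0)"
    by (auto simp: simplicial_cycles_def)
  have down: "H \<in> K'" if "J \<in> K'" "H \<subseteq> J" for H J
    using K' that unfolding simplicial_complex_def by blast
  have notK: "H \<notin> K" if "R \<subseteq> H" for H using K R that unfolding simplicial_complex_def by blast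
  have sub: "K \<subseteq> K'" using K'_eq by blast
  have bdK: "simplicial_boundaries K i \<subseteq> (simplicial_boundaries K' i :: ('a set \<Rightarrow> 'k) set)"
  proof
    fix b :: "'a set \<Rightarrow> 'k" assume "b \<in> simplicial_boundaries K i"
    then obtain e where e: "e \<in> simplicial_chains K (i + 1)" "b = boundary K e"
      unfolding simplicial_boundaries_def by blast
    have "e \<in> simplicial_chains K' (i + 1)" using e(1) simplicial_chains_mono[OF sub] by blast
    then show "b \<in> simplicial_boundaries K' i"
      unfolding simplicial_boundaries_def e(2) boundary_mono[OF K' sub e(1)] by blast
  qed
  have K_cycle: "e \<in> simplicial_boundaries K i"
    if "e \<in> simplicial_chains K i" "boundary K' e = (\<lambda>_. 0)" for e :: "'a set \<Rightarrow> 'k"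
    by (rule subsetD[OF IH]) (use that boundary_mono[OF K' sub that(1)] in \<open>simp add: simplicial_cycles_def\<close>)
  show "c \<in> simplicial_boundaries K' i"
  proof (cases "R = F")
    case True
    then have "c \<in> simplicial_chains K i"
      using chain top K'_eq by (auto simp: simplicial_chains_def)
    then show ?thesis using K_cycle bc bdK by blast
  next
    case False
    then obtain v where v: "v \<in> F" "v \<notin> R" using R by blast
    let ?V = "\<Union>K'"
    have fin: "finite ?V" by (rule simplicial_complex_finite_vertices[OF K'])
    have FK': "F \<in> K'" using K'_eq R by blast
    define new where "new = (\<lambda>H. if R \<subseteq> H then c H else 0)"
    define e where "e = cone v new"
    have new_eq: "R \<subseteq> H \<and> H \<subseteq> F" if "new H \<noteq> 0" for H
      using that simplicial_chainsD[OF chain, of H] notK K'_eq by (auto simp: new_def split: if_splits)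
    have e: "e \<in> simplicial_chains K' (i + 1)"
      unfolding simplicial_chains_def
    proof safe
      fix H assume "e H \<noteq> 0"
      then have H: "v \<in> H" "new (H - {v}) \<noteq> 0" by (auto simp: e_def cone_def split: if_splits)
      then have "H \<subseteq> F" using new_eq[OF H(2)] v by auto
      then show "H \<in> K'" using FK' down by blast
      then have "finite H" using K' unfolding simplicial_complex_def by blast
      moreover have "face_dim (H - {v}) = i"
        using H(2) simplicial_chainsD[OF chain] by (auto simp: new_def split: if_splits)
      ultimately show "face_dim H = i + 1"
        using card.remove[of H v] H(1) by (simp only: face_dim_def)
    qed
    define c' where "c' = (\<lambda>H. c H - boundary K' e H)"
    have c'_chain: "c' \<in> simplicial_chains K' i"
      unfolding c'_def using simplicial_chains_diff[OF chain boundary_in_simplicial_chains[OF K' e]] .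
    have c'_bd: "boundary K' c' = (\<lambda>_. 0)"
      unfolding c'_def boundary_diff boundary_boundary[OF K' e] bc by simp
    have vanish: "c' H = 0" if "R \<subseteq> H" "H \<subseteq> F" for H
    proof -
      have HV: "H \<subseteq> ?V" using that FK' by blast
      have vV: "v \<in> ?V" using v FK' by blast
      have "boundary K' e H + cone v (ambient_boundary ?V new) H = new H"
        using cone_homotopy[OF fin HV vV, of new] boundary_eq_ambient_boundary[OF fin order.refl e]
        by (simp add: e_def)
      then have eq: "c' H = cone v (ambient_boundary ?V new) H"
        using that by (simp add: c'_def new_def algebra_simps)
      show ?thesis
      proof (cases "v \<in> H")
        case True
        have "ambient_boundary ?V new (H - {v}) = ambient_boundary ?V c (H - {v})"
          unfolding ambient_boundary_def
          by (rule sum.cong[OF refl]) (use that v in \<open>auto simp: new_def\<close>)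
        also have "\<dots> = 0"
          using bc boundary_eq_ambient_boundary[OF fin order.refl chain] by simp
        finally show ?thesis unfolding eq cone_def by simp
      qed (simp add: eq cone_def)
    qed
    have "H \<in> K \<and> face_dim H = i" if "c' H \<noteq> 0" for H
      using simplicial_chainsD[OF c'_chain that] vanish[of H] that K'_eq by auto
    then have "c' \<in> simplicial_chains K i" by (simp add: simplicial_chains_def)
    then have "c' \<in> simplicial_boundaries K' i" using K_cycle c'_bd bdK by blast
    then obtain e' where e': "e' \<in> simplicial_chains K' (i + 1)" "c' = boundary K' e'"
      unfolding simplicial_boundaries_def by blast
    have "c = boundary K' (\<lambda>F. e' F + e F)"
      unfolding boundary_add by (simp add: c'_def flip: e'(2))
    then show ?thesis
      unfolding simplicial_boundaries_def using simplicial_chains_add[OF e'(1) e] by blast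
  qed
qed

section \<open>Facets, links and deletions\<close>

lemma simplicial_complexI_subsets:
  assumes "finite V" "\<And>F. F \<in> \<Delta> \<Longrightarrow> F \<subseteq> V" "\<And>F H. F \<in> \<Delta> \<Longrightarrow> H \<subseteq> F \<Longrightarrow> H \<in> \<Delta>"
  shows "simplicial_complex \<Delta>"
proof -
  have "\<Delta> \<subseteq> Pow V" using assms(2) by blast
  then have "finite \<Delta>" using assms(1) finite_subset by blast
  then show ?thesis unfolding simplicial_complex_def using assms by (auto intro: finite_subset)
qed

lemma simplicial_complex_link: "simplicial_complex \<Delta> \<Longrightarrow> simplicial_complex (link \<Delta> F)"
  unfolding simplicial_complex_def link_def by simp (metis Un_mono disjoint_iff order_refl subsetD)

lemma simplicial_complex_deletion: "simplicial_complex \<Delta> \<Longrightarrow> simplicial_complex (deletion \<Delta> F)"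
  unfolding simplicial_complex_def deletion_def by simp (metis subset_trans)

lemma simplicial_complex_down: "simplicial_complex \<Delta> \<Longrightarrow> F \<in> \<Delta> \<Longrightarrow> H \<subseteq> F \<Longrightarrow> H \<in> \<Delta>"
  unfolding simplicial_complex_def by blast

lemma simplicial_complex_finite_face: "simplicial_complex \<Delta> \<Longrightarrow> F \<in> \<Delta> \<Longrightarrow> finite F"
  unfolding simplicial_complex_def by blast

lemma facetsD: "F \<in> facets \<Delta> \<Longrightarrow> F \<in> \<Delta>"
  unfolding facets_def by blast

lemma face_in_facet:
  assumes "simplicial_complex \<Delta>" "H \<in> \<Delta>"
  obtains F where "F \<in> facets \<Delta>" "H \<subseteq> F"
proof -
  have "finite \<Delta>" using assms(1) unfolding simplicial_complex_def by blast
  from finite_has_maximal2[OF this assms(2)]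
  obtain F where F: "F \<in> \<Delta>" "H \<subseteq> F" "\<forall>J\<in>\<Delta>. F \<subseteq> J \<longrightarrow> F = J"
    by auto
  then have "F \<in> facets \<Delta>" by (auto simp: facets_def)
  then show thesis using that F(2) by simp
qed

lemma pure_complexD: "pure_complex \<Delta> \<Longrightarrow> simplicial_complex \<Delta>"
  unfolding pure_complex_def by blast

lemma pure_complex_facet_card:
  "pure_complex \<Delta> \<Longrightarrow> F \<in> facets \<Delta> \<Longrightarrow> H \<in> facets \<Delta> \<Longrightarrow> card F = card H"
  unfolding pure_complex_def face_dim_def by fastforce

lemma pure_complex_face_card:
  assumes "pure_complex \<Delta>" "F \<in> facets \<Delta>" "H \<in> \<Delta>"
  shows "card H \<le> card F"
proof -
  note sc = pure_complexD[OF assms(1)]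
  obtain F' where "F' \<in> facets \<Delta>" "H \<subseteq> F'" using face_in_facet[OF sc assms(3)] .
  then show ?thesis
    using pure_complex_facet_card[OF assms(1,2), of F'] simplicial_complex_finite_face[OF sc]
    by (metis card_mono facetsD)
qed

lemma pure_complexI:
  "simplicial_complex \<Delta> \<Longrightarrow> (\<And>F. F \<in> facets \<Delta> \<Longrightarrow> card F = m) \<Longrightarrow> pure_complex \<Delta>"
  unfolding pure_complex_def face_dim_def by simp

lemma facets_link_vertex:
  assumes sc: "simplicial_complex \<Delta>"
  shows "facets (link \<Delta> {x}) = (\<lambda>F. F - {x}) ` {F \<in> facets \<Delta>. x \<in> F}"
proof (intro equalityI subsetI)
  fix A assume A: "A \<in> facets (link \<Delta> {x})"
  then have A': "x \<notin> A" "insert x A \<in> \<Delta>" unfolding facets_def link_def by auto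
  have "H = insert x A" if H: "H \<in> \<Delta>" "insert x A \<subseteq> H" for H
  proof -
    have "insert x (H - {x}) = H" using H by blast
    then have "H - {x} \<in> link \<Delta> {x}"
      using H simplicial_complex_down[OF sc H(1), of "H - {x}"] unfolding link_def by auto
    moreover have "A \<subseteq> H - {x}" using H A' by blast
    ultimately have "H - {x} = A" using A unfolding facets_def by blast
    then show ?thesis using H by blast
  qed
  then have "insert x A \<in> facets \<Delta>" using A' unfolding facets_def by blast
  then show "A \<in> (\<lambda>F. F - {x}) ` {F \<in> facets \<Delta>. x \<in> F}"
    using A'(1) by (intro image_eqI[of _ _ "insert x A"]) auto
next
  fix A assume "A \<in> (\<lambda>F. F - {x}) ` {F \<in> facets \<Delta>. x \<in> F}"
  then obtain F where F: "F \<in> facets \<Delta>" "x \<in> F" "A = F - {x}" by blast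
  have "insert x A = F" using F by blast
  then have "A \<in> link \<Delta> {x}"
    using F facetsD[OF F(1)] simplicial_complex_down[OF sc facetsD[OF F(1)], of A]
    unfolding link_def by auto
  moreover have "H = A" if "H \<in> link \<Delta> {x}" "A \<subseteq> H" for H
  proof -
    have H: "x \<notin> H" "insert x H \<in> \<Delta>" using that unfolding link_def by auto
    have "F \<subseteq> insert x H" using that F by blast
    then have "insert x H = F" using F H unfolding facets_def by blast
    then show ?thesis using F H by blast
  qed
  ultimately show "A \<in> facets (link \<Delta> {x})" unfolding facets_def by blast
qed

lemma pure_complex_link_vertex:
  assumes "pure_complex \<Delta>"
  shows "pure_complex (link \<Delta> {x})"
proof -
  note sc = pure_complexD[OF assms]
  show ?thesis
  proof (cases "\<exists>F\<in>facets \<Delta>. x \<in> F")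
    case True
    then obtain F where F: "F \<in> facets \<Delta>" "x \<in> F" by blast
    show ?thesis
    proof (rule pure_complexI[OF simplicial_complex_link[OF sc]])
      fix A assume "A \<in> facets (link \<Delta> {x})"
      then obtain F' where "F' \<in> facets \<Delta>" "x \<in> F'" "A = F' - {x}"
        unfolding facets_link_vertex[OF sc] by blast
      then show "card A = card F - 1" using pure_complex_facet_card[OF assms F(1)] by simp
    qed
  next
    case False
    then have "facets (link \<Delta> {x}) = {}" unfolding facets_link_vertex[OF sc] by blast
    then show ?thesis using simplicial_complex_link[OF sc] unfolding pure_complex_def by blast
  qed
qed

text \<open>The deletion of \<open>x\<close> may lose a dimension, namely when every facet contains \<open>x\<close>. Otherwise purity of
  both complexes forces the facets of the deletion to have full dimension, so none of them is
  the trace of a facet through \<open>x\<close>.\<close>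

lemma facets_deletion_vertex:
  assumes pure: "pure_complex \<Delta>" "pure_complex (deletion \<Delta> {x})"
    and F0: "F0 \<in> facets \<Delta>" "x \<notin> F0"
  shows "facets (deletion \<Delta> {x}) = {F \<in> facets \<Delta>. x \<notin> F}"
proof -
  have sub: "F \<in> facets (deletion \<Delta> {x})" if "F \<in> facets \<Delta>" "x \<notin> F" for F
    using that unfolding facets_def deletion_def by blast
  moreover have "A \<in> facets \<Delta> \<and> x \<notin> A" if A: "A \<in> facets (deletion \<Delta> {x})" for A
  proof -
    have A': "A \<in> \<Delta>" "x \<notin> A" using facetsD[OF A] unfolding deletion_def by auto
    obtain F where F: "F \<in> facets \<Delta>" "A \<subseteq> F" using face_in_facet[OF pure_complexD[OF pure(1)] A'(1)] .
    have "card A = card F"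
      using pure_complex_facet_card[OF pure(2) A sub[OF F0]] pure_complex_facet_card[OF pure(1) F0(1) F(1)]
      by simp
    then have "A = F"
      using F simplicial_complex_finite_face[OF pure_complexD[OF pure(1)] facetsD[OF F(1)]]
      by (simp add: card_subset_eq)
    then show ?thesis using F A' by blast
  qed
  ultimately show ?thesis by blast
qed

section \<open>Vertex decomposable complexes are shellable\<close>

definition shelling :: "'a set list \<Rightarrow> bool" where
  "shelling Fs \<longleftrightarrow> (\<forall>i<length Fs. \<forall>j<i. \<exists>x\<in>Fs ! i - Fs ! j. \<exists>l<i. Fs ! i - Fs ! l = {x})"

lemma shellable_iff:
  "shellable \<Delta> \<longleftrightarrow> pure_complex \<Delta> \<and> (\<exists>Fs. distinct Fs \<and> set Fs = facets \<Delta> \<and> shelling Fs)"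
  unfolding shellable_def shelling_def ..

lemma shelling_map_insert:
  assumes "shelling Fs" "\<And>F. F \<in> set Fs \<Longrightarrow> x \<notin> F"
  shows "shelling (map (insert x) Fs)"
  unfolding shelling_def
proof (intro allI impI)
  fix i j assume ij: "i < length (map (insert x) Fs)" "j < i"
  have diff: "insert x (Fs ! i) - insert x (Fs ! l) = Fs ! i - Fs ! l" for l
    using assms(2)[of "Fs ! i"] ij by auto
  then show "\<exists>y\<in>map (insert x) Fs ! i - map (insert x) Fs ! j. \<exists>l<i. map (insert x) Fs ! i - map (insert x) Fs ! l = {y}"
  proof -
    obtain y l where y: "y \<in> Fs ! i - Fs ! j" "l < i" "Fs ! i - Fs ! l = {y}"
      using assms(1) ij unfolding shelling_def by (metis length_map)
    have nth: "map (insert x) Fs ! q = insert x (Fs ! q)" if "q \<le> i" for q using that ij by simp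
    have "y \<in> insert x (Fs ! i) - insert x (Fs ! j)" unfolding diff by (rule y(1))
    then show ?thesis using y(2,3) ij by (intro bexI[of _ y] exI[of _ l]) (simp_all add: nth diff)
  qed
qed

lemma vertex_decomposable_imp_pure: "vertex_decomposable \<Delta> \<Longrightarrow> pure_complex \<Delta>"
  by (auto elim: vertex_decomposable.cases)

lemma shelling_append:
  assumes Ds: "shelling Ds" and Ls: "shelling Ls"
    and cross: "\<And>F H. F \<in> set Ls \<Longrightarrow> H \<in> set Ds \<Longrightarrow> \<exists>x\<in>F - H. \<exists>D\<in>set Ds. F - D = {x}"
  shows "shelling (Ds @ Ls)"
  unfolding shelling_def
proof (intro allI impI)
  fix i j assume ij: "i < length (Ds @ Ls)" "j < i"
  let ?F = "(!) (Ds @ Ls)" and ?m = "length Ds"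
  consider "i < ?m" | "?m \<le> i" "j < ?m" | "?m \<le> j" by linarith
  then show "\<exists>x\<in>?F i - ?F j. \<exists>l<i. ?F i - ?F l = {x}"
  proof cases
    case 1
    then obtain x l where "x \<in> Ds ! i - Ds ! j" "l < i" "Ds ! i - Ds ! l = {x}"
      using Ds ij unfolding shelling_def by blast
    then have "x \<in> ?F i - ?F j" "?F i - ?F l = {x}" using 1 ij by (auto simp: nth_append)
    then show ?thesis using \<open>l < i\<close> by blast
  next
    case 2
    have "?F i \<in> set Ls" "?F j \<in> set Ds" using 2 ij by (auto simp: nth_append)
    then obtain x D where xD: "x \<in> ?F i - ?F j" "D \<in> set Ds" "?F i - D = {x}" using cross by blast
    then obtain l where "l < ?m" "Ds ! l = D" by (auto simp: in_set_conv_nth)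
    then have "l < i" "?F l = D" using 2 by (auto simp: nth_append)
    then show ?thesis using xD by blast
  next
    case 3
    define i' j' where "i' = i - ?m" "j' = j - ?m"
    have i'j': "i' < length Ls" "j' < i'" using 3 ij by (auto simp: i'_j'_def)
    then obtain x l where l: "x \<in> Ls ! i' - Ls ! j'" "l < i'" "Ls ! i' - Ls ! l = {x}"
      using Ls unfolding shelling_def by blast
    have "?F i = Ls ! i'" "?F j = Ls ! j'" "?F (?m + l) = Ls ! l" "?m + l < i"
      using 3 ij l by (auto simp: nth_append i'_j'_def)
    then show ?thesis using l by metis
  qed
qed

text \<open>List a shelling of the deletion first and then a shelling of the link, coned over \<open>x\<close>. A facet
  \<open>F\<close> through \<open>x\<close> meets the deletion in \<open>F - {x}\<close>, which lies in some facet \<open>D\<close> of the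
  deletion, so \<open>F - D = {x}\<close>. If every facet contains \<open>x\<close>, the complex is a cone and the second
  list alone is a shelling.\<close>

lemma vertex_decomposable_imp_shellable: "vertex_decomposable \<Delta> \<Longrightarrow> shellable \<Delta>"
proof (induction rule: vertex_decomposable.induct)
  case (simplex \<Delta>)
  then show ?case
    unfolding shellable_iff by (intro conjI exI[of _ "[\<Union>\<Delta>]"]) (auto simp: shelling_def)
next
  case (vertex \<Delta> x)
  note sc = pure_complexD[OF vertex.hyps(1)]
  obtain Ls where Ls: "distinct Ls" "set Ls = facets (link \<Delta> {x})" "shelling Ls"
    using vertex.IH(1) unfolding shellable_iff by blast
  obtain Ds where Ds: "distinct Ds" "set Ds = facets (deletion \<Delta> {x})" "shelling Ds"
    using vertex.IH(2) unfolding shellable_iff by blast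
  have x_notin: "x \<notin> A" if "A \<in> set Ls" for A
    using that unfolding Ls(2) facets_link_vertex[OF sc] by blast
  define Ls' where "Ls' = map (insert x) Ls"
  have dist': "distinct Ls'"
    unfolding Ls'_def distinct_map
  proof (intro conjI inj_onI)
    fix A B assume "A \<in> set Ls" "B \<in> set Ls" "insert x A = insert x B"
    then show "A = B" using x_notin[of A] x_notin[of B] by (simp add: insert_ident)
  qed (rule Ls(1))
  have sh': "shelling Ls'" unfolding Ls'_def by (rule shelling_map_insert[OF Ls(3) x_notin])
  have "set Ls' = insert x ` (\<lambda>F. F - {x}) ` {F \<in> facets \<Delta>. x \<in> F}"
    unfolding Ls'_def by (simp add: Ls(2) facets_link_vertex[OF sc])
  also have "\<dots> = {F \<in> facets \<Delta>. x \<in> F}"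
    by (simp add: image_image insert_absorb cong: image_cong_simp)
  finally have set': "set Ls' = {F \<in> facets \<Delta>. x \<in> F}" .
  show ?case
  proof (cases "\<exists>F\<in>facets \<Delta>. x \<notin> F")
    case False
    then have "set Ls' = facets \<Delta>" using set' by blast
    then show ?thesis unfolding shellable_iff using vertex.hyps(1) dist' sh' by blast
  next
    case True
    have "pure_complex (deletion \<Delta> {x})"
      using vertex.hyps(4) by (rule vertex_decomposable_imp_pure)
    then have setD: "set Ds = {F \<in> facets \<Delta>. x \<notin> F}"
      using True facets_deletion_vertex[OF vertex.hyps(1)] Ds(2) by blast
    have "shelling (Ds @ Ls')"
    proof (rule shelling_append[OF Ds(3) sh'])
      fix F H assume F: "F \<in> set Ls'" and H: "H \<in> set Ds"
      have F': "F \<in> facets \<Delta>" "x \<in> F" using F set' by blast+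
      have "F - {x} \<in> deletion \<Delta> {x}"
        using simplicial_complex_down[OF sc facetsD[OF F'(1)], of "F - {x}"]
        unfolding deletion_def by simp
      then obtain D where D: "D \<in> facets (deletion \<Delta> {x})" "F - {x} \<subseteq> D"
        using face_in_facet[OF simplicial_complex_deletion[OF sc]] by blast
      have "x \<notin> D" using D(1) Ds(2) setD by blast
      then have "F - D = {x}" using F' D by blast
      then show "\<exists>y\<in>F - H. \<exists>D\<in>set Ds. F - D = {y}"
        using F'(2) H setD D(1) Ds(2) by (intro bexI[of _ x] bexI[of _ D]) auto
    qed
    moreover have "distinct (Ds @ Ls')" using Ds(1) dist' setD set' by auto
    moreover have "set (Ds @ Ls') = facets \<Delta>" using setD set' by auto
    ultimately show ?thesis unfolding shellable_iff using vertex.hyps(1) by blast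
  qed
qed

section \<open>Shellable complexes are Cohen-Macaulay\<close>

lemma simplicial_chains_empty: "simplicial_chains {} i = {\<lambda>_. 0}"
  by (auto simp: simplicial_chains_def)

lemma simplicial_boundaries_zero: "(\<lambda>_. 0) \<in> simplicial_boundaries \<Delta> i"
  unfolding simplicial_boundaries_def
  using imageI[OF simplicial_chains_zero, of "boundary \<Delta>"] by simp

text \<open>Let \<open>K m\<close> be the complex generated by the first \<open>m\<close> facets. A face of the next facet \<open>F\<close> is old
  iff it does not contain the restriction \<open>R\<close>, the set of \<open>x\<close> for which \<open>F - {x}\<close> is covered by
  an earlier facet. Therefore the link of \<open>G\<close> either does not change or grows by the interval
  \<open>[R - G, F - G]\<close>, and \<open>attach_face_acyclic\<close> applies. Treating the link of \<open>G\<close> in \<open>K m\<close>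
  directly avoids having to extract a shelling of the link from that of the complex.\<close>

lemma shelling_link_acyclic:
  fixes Fs :: "'a::linorder set list"
  assumes sh: "shelling Fs" and fin: "\<And>F. F \<in> set Fs \<Longrightarrow> finite F"
    and dim: "\<And>F. F \<in> set Fs \<Longrightarrow> G \<subseteq> F \<Longrightarrow> i < face_dim (F - G)"
    and "m \<le> length Fs"
  defines "K \<equiv> \<lambda>m. {H. \<exists>j<m. H \<subseteq> Fs ! j}"
  shows "simplicial_cycles (link (K m) G) i
    \<subseteq> (simplicial_boundaries (link (K m) G) i :: ('a set \<Rightarrow> 'k::field) set)"
  using \<open>m \<le> length Fs\<close>
proof (induction m)
  case 0
  have "link (K 0) G = {}" by (simp add: K_def link_def)
  then show ?case
    using simplicial_boundaries_zero[of "{}" i]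
    by (auto simp: simplicial_cycles_def simplicial_chains_empty)
next
  case (Suc m)
  define F where "F = Fs ! m"
  have F: "F \<in> set Fs" using Suc.prems by (simp add: F_def)
  have sc: "simplicial_complex (K q)" if "q \<le> length Fs" for q
  proof -
    have "K q = (\<Union>j<q. Pow (Fs ! j))" by (auto simp: K_def)
    moreover have "finite (Fs ! j)" if "j < q" for j using fin that \<open>q \<le> length Fs\<close> by simp
    ultimately show ?thesis unfolding simplicial_complex_def by (auto intro: finite_subset) (meson lessThan_iff order_trans)
  qed
  have K_Suc: "K (Suc m) = K m \<union> Pow F" by (auto simp: K_def F_def less_Suc_eq)
  show ?case
  proof (cases "G \<subseteq> F")
    case False
    have "link (K (Suc m)) G = link (K m) G"
      unfolding link_def K_Suc using False sc[of m] Suc.prems simplicial_complex_down[of "K m"] by auto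
    then show ?thesis using Suc by simp
  next
    case True
    define R where "R = {x \<in> F. \<exists>l<m. F - Fs ! l = {x}}"
    have old: "H \<in> K m \<longleftrightarrow> \<not> R \<subseteq> H" if "H \<subseteq> F" for H
    proof
      assume "H \<in> K m"
      then obtain j where j: "j < m" "H \<subseteq> Fs ! j" by (auto simp: K_def)
      then obtain x l where "x \<in> F - Fs ! j" "l < m" "F - Fs ! l = {x}"
        using sh Suc.prems unfolding shelling_def F_def by (metis Suc_le_lessD)
      then show "\<not> R \<subseteq> H" using j by (auto simp: R_def)
    next
      assume "\<not> R \<subseteq> H"
      then obtain x l where x: "x \<in> F" "x \<notin> H" "l < m" "F - Fs ! l = {x}" by (auto simp: R_def)
      have "H \<subseteq> Fs ! l"
      proof
        fix y assume "y \<in> H"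
        then have "y \<in> F" "y \<notin> {x}" using \<open>H \<subseteq> F\<close> x(2) by blast+
        then show "y \<in> Fs ! l" unfolding x(4)[symmetric] by blast
      qed
      then show "H \<in> K m" using x(3) by (auto simp: K_def)
    qed
    have RF: "R \<subseteq> F" by (auto simp: R_def)
    have down: "H \<in> K m" if "J \<in> K m" "H \<subseteq> J" for H J
      using sc[of m] Suc.prems simplicial_complex_down that by (metis Suc_leD)
    have link_Suc: "link (K (Suc m)) G = link (K m) G \<union> {H. R - G \<subseteq> H \<and> H \<subseteq> F - G}"
    proof (intro equalityI subsetI)
      fix H assume "H \<in> link (K (Suc m)) G"
      then have H: "G \<inter> H = {}" "G \<union> H \<in> K m \<or> G \<union> H \<subseteq> F" by (auto simp: link_def K_Suc)
      show "H \<in> link (K m) G \<union> {H. R - G \<subseteq> H \<and> H \<subseteq> F - G}"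
      proof (cases "G \<union> H \<in> K m")
        case True
        then show ?thesis using H down[OF True, of H] by (auto simp: link_def)
      next
        case False
        then have "R \<subseteq> G \<union> H" using H old[of "G \<union> H"] by blast
        then show ?thesis using H False by blast
      qed
    next
      fix H assume "H \<in> link (K m) G \<union> {H. R - G \<subseteq> H \<and> H \<subseteq> F - G}"
      then show "H \<in> link (K (Suc m)) G" using True by (auto simp: link_def K_Suc)
    qed
    show ?thesis
    proof (rule attach_face_acyclic[OF _ _ link_Suc])
      show "simplicial_complex (link (K m) G)" "simplicial_complex (link (K (Suc m)) G)"
        using sc Suc.prems by (simp_all add: simplicial_complex_link)
      show "R - G \<subseteq> F - G" using RF by blast
      have "G \<union> (R - G) \<notin> K m" using old[of "G \<union> (R - G)"] RF True by blast
      then show "R - G \<notin> link (K m) G" by (simp add: link_def)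
      show "i < face_dim (F - G)" using dim[OF F True] .
    qed (use Suc in simp)
  qed
qed

lemma shellable_imp_cohen_macaulay:
  fixes \<Delta> :: "'a::linorder set set"
  assumes "shellable \<Delta>"
  shows "cohen_macaulay TYPE('k::field) \<Delta>"
proof -
  obtain Fs where pure: "pure_complex \<Delta>" and Fs: "set Fs = facets \<Delta>" "shelling Fs"
    using assms unfolding shellable_iff by blast
  note sc = pure_complexD[OF pure]
  have K: "{H. \<exists>j<length Fs. H \<subseteq> Fs ! j} = \<Delta>"
  proof (intro equalityI subsetI)
    fix H assume "H \<in> {H. \<exists>j<length Fs. H \<subseteq> Fs ! j}"
    then obtain F where "F \<in> facets \<Delta>" "H \<subseteq> F" using Fs(1) nth_mem by blast
    then show "H \<in> \<Delta>" using sc simplicial_complex_down facetsD by blast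
  next
    fix H assume "H \<in> \<Delta>"
    then obtain F where "F \<in> set Fs" "H \<subseteq> F" using face_in_facet[OF sc] Fs(1) by blast
    then show "H \<in> {H. \<exists>j<length Fs. H \<subseteq> Fs ! j}" by (auto simp: in_set_conv_nth)
  qed
  have "trivial_group (reduced_homology TYPE('k) (link \<Delta> G) i)"
    if G: "G \<in> \<Delta>" and i: "i < complex_dim (link \<Delta> G)" for G i
  proof -
    have dim: "i < face_dim (F - G)" if F: "F \<in> set Fs" "G \<subseteq> F" for F
    proof -
      have "finite (link \<Delta> G)"
        using simplicial_complex_link[OF sc] unfolding simplicial_complex_def by blast
      moreover have "{} \<in> link \<Delta> G" using G simplicial_complex_down[OF sc G] by (simp add: link_def)
      ultimately have "complex_dim (link \<Delta> G) \<in> face_dim ` link \<Delta> G"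
        unfolding complex_dim_def by (intro Max_in) auto
      then obtain H where H: "H \<in> link \<Delta> G" "i < face_dim H" using i by auto
      have fins: "finite G" "finite H" using sc G H simplicial_complex_finite_face
        unfolding link_def by blast+
      have "card G + card H = card (G \<union> H)"
        using H(1) fins by (simp add: card_Un_disjoint link_def)
      also have "\<dots> \<le> card F"
        using pure_complex_face_card[OF pure] F H(1) unfolding Fs(1) link_def by blast
      finally show ?thesis using H(2) F fins by (simp add: face_dim_def card_Diff_subset)
    qed
    have fin: "finite F" if "F \<in> set Fs" for F
      using that sc Fs(1) facetsD simplicial_complex_finite_face by blast
    have "simplicial_cycles (link \<Delta> G) i \<subseteq> (simplicial_boundaries (link \<Delta> G) i :: ('a set \<Rightarrow> 'k) set)"
      using shelling_link_acyclic[OF Fs(2) fin dim order_refl] unfolding K by blast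
    then show ?thesis by (simp add: trivial_reduced_homology_iff simplicial_complex_link[OF sc])
  qed
  then show ?thesis unfolding cohen_macaulay_def using pure by blast
qed

text \<open>The link of \<open>F\<close> in the link of \<open>x\<close> is the link of \<open>insert x F\<close>.\<close>

lemma cohen_macaulay_imp_buchsbaum:
  fixes \<Delta> :: "'a::linorder set set"
  assumes "cohen_macaulay TYPE('k::field) \<Delta>"
  shows "buchsbaum TYPE('k) \<Delta>"
proof -
  have pure: "pure_complex \<Delta>" using assms unfolding cohen_macaulay_def by blast
  note sc = pure_complexD[OF pure]
  have "cohen_macaulay TYPE('k) (link \<Delta> {x})" for x
    unfolding cohen_macaulay_def
  proof (intro conjI ballI allI impI)
    show "pure_complex (link \<Delta> {x})" by (rule pure_complex_link_vertex[OF pure])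
    fix F i assume F: "F \<in> link \<Delta> {x}" and i: "i < complex_dim (link (link \<Delta> {x}) F)"
    have mem: "insert x F \<in> \<Delta>" using F unfolding link_def by simp
    have "link (link \<Delta> {x}) F = link \<Delta> (insert x F)"
    proof (intro equalityI subsetI)
      fix H assume "H \<in> link (link \<Delta> {x}) F"
      then show "H \<in> link \<Delta> (insert x F)" unfolding link_def by simp
    next
      fix H assume H: "H \<in> link \<Delta> (insert x F)"
      then have all: "insert x (F \<union> H) \<in> \<Delta>" "x \<notin> H" "F \<inter> H = {}" unfolding link_def by auto
      have "x \<notin> F" using F unfolding link_def by simp
      then show "H \<in> link (link \<Delta> {x}) F"
        using all simplicial_complex_down[OF sc all(1), of H]
          simplicial_complex_down[OF sc all(1), of "insert x H"]
          simplicial_complex_down[OF sc all(1), of "F \<union> H"]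
        unfolding link_def by auto
    qed
    then show "trivial_group (reduced_homology TYPE('k) (link (link \<Delta> {x}) F) i)"
      using assms mem i unfolding cohen_macaulay_def by simp
  qed
  then show ?thesis using pure unfolding buchsbaum_def by blast
qed

section \<open>Well-covered graphs and pure independence complexes\<close>

definition edges_within :: "'a graph \<Rightarrow> bool" where
  "edges_within G \<longleftrightarrow> (\<forall>e\<in>snd G. \<exists>a\<in>fst G. \<exists>b\<in>fst G. a \<noteq> b \<and> e = {a, b})"

lemma vertex_cover_iff_independent:
  assumes "edges_within G"
  shows "vertex_cover G C \<longleftrightarrow> C \<subseteq> fst G \<and> fst G - C \<in> independence_complex G"
proof -
  have "(\<forall>e\<in>snd G. e \<inter> C \<noteq> {}) \<longleftrightarrow> indep (fst G - C) (snd G)" if "C \<subseteq> fst G"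
  proof
    assume *: "\<forall>e\<in>snd G. e \<inter> C \<noteq> {}"
    show "indep (fst G - C) (snd G)" unfolding indep_def using * by fastforce
  next
    assume *: "indep (fst G - C) (snd G)"
    show "\<forall>e\<in>snd G. e \<inter> C \<noteq> {}"
    proof
      fix e assume e: "e \<in> snd G"
      then obtain a b where ab: "a \<in> fst G" "b \<in> fst G" "a \<noteq> b" "e = {a, b}"
        using assms unfolding edges_within_def by blast
      have "a \<in> C \<or> b \<in> C"
        using * e ab unfolding indep_def by blast
      then show "e \<inter> C \<noteq> {}" using ab(4) by blast
    qed
  qed
  then show ?thesis unfolding vertex_cover_def independence_complex_def by blast
qed

text \<open>A set of vertices covers all edges iff its complement is independent, and complementation
  reverses inclusion.\<close>

lemma minimal_vertex_cover_iff_facet: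
  assumes "edges_within G"
  shows "minimal_vertex_cover G C \<longleftrightarrow> C \<subseteq> fst G \<and> fst G - C \<in> facets (independence_complex G)"
proof -
  note vc = vertex_cover_iff_independent[OF assms]
  let ?V = "fst G" and ?I = "independence_complex G"
  have sub: "H \<subseteq> ?V" if "H \<in> ?I" for H using that by (simp add: independence_complex_def)
  show ?thesis
  proof
    assume C: "minimal_vertex_cover G C"
    then have C': "C \<subseteq> ?V" "?V - C \<in> ?I" unfolding minimal_vertex_cover_def vc by simp_all
    have "H = ?V - C" if H: "H \<in> ?I" "?V - C \<subseteq> H" for H
    proof (rule ccontr)
      assume "H \<noteq> ?V - C"
      then have "?V - H \<subset> C" using H sub[OF H(1)] C'(1) by blast
      moreover have "?V - (?V - H) = H" using sub[OF H(1)] by blast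
      ultimately have "vertex_cover G (?V - H)" using H(1) unfolding vc by simp
      then show False using C \<open>?V - H \<subset> C\<close> unfolding minimal_vertex_cover_def by simp
    qed
    then show "C \<subseteq> ?V \<and> ?V - C \<in> facets ?I" using C' unfolding facets_def by simp
  next
    assume C: "C \<subseteq> ?V \<and> ?V - C \<in> facets ?I"
    have "\<not> vertex_cover G D" if D: "D \<subset> C" for D
    proof
      assume "vertex_cover G D"
      then have "?V - D \<in> ?I" unfolding vc by simp
      moreover have "?V - C \<subseteq> ?V - D" using D by blast
      ultimately have "?V - D = ?V - C" using C unfolding facets_def by simp
      then show False using C D by blast
    qed
    then show "minimal_vertex_cover G C"
      using C unfolding minimal_vertex_cover_def vc facets_def by simp
  qed
qed

lemma simplicial_complex_independence_complex:
  assumes "finite (fst G)"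
  shows "simplicial_complex (independence_complex G)"
  by (rule simplicial_complexI_subsets[OF assms])
    (auto simp: independence_complex_def intro: smaller_indep)

lemma well_covered_iff_pure:
  assumes "finite (fst G)" "edges_within G"
  shows "well_covered G \<longleftrightarrow> pure_complex (independence_complex G)"
proof -
  let ?V = "fst G" and ?I = "independence_complex G"
  note mvc = minimal_vertex_cover_iff_facet[OF assms(2)]
  have sub: "F \<subseteq> ?V" if "F \<in> facets ?I" for F
    using facetsD[OF that] by (simp add: independence_complex_def)
  have compl: "card (?V - C) = card ?V - card C \<and> card C \<le> card ?V" if "C \<subseteq> ?V" for C
    using that assms(1) by (simp add: card_Diff_subset card_mono finite_subset)
  have "well_covered G \<longleftrightarrow> (\<forall>F\<in>facets ?I. \<forall>H\<in>facets ?I. card F = card H)"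
  proof
    assume wc: "well_covered G"
    show "\<forall>F\<in>facets ?I. \<forall>H\<in>facets ?I. card F = card H"
    proof (intro ballI)
      fix F H assume FH: "F \<in> facets ?I" "H \<in> facets ?I"
      then have "?V - (?V - F) = F" "?V - (?V - H) = H" using sub by blast+
      then have "minimal_vertex_cover G (?V - F)" "minimal_vertex_cover G (?V - H)"
        using FH by (simp_all add: mvc)
      then have "card (?V - F) = card (?V - H)" using wc unfolding well_covered_def by blast
      then show "card F = card H" using compl[OF sub[OF FH(1)]] compl[OF sub[OF FH(2)]] by linarith
    qed
  next
    assume *: "\<forall>F\<in>facets ?I. \<forall>H\<in>facets ?I. card F = card H"
    show "well_covered G"
      unfolding well_covered_def
    proof (intro allI impI)
      fix C D assume "minimal_vertex_cover G C" "minimal_vertex_cover G D"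
      then have CD: "C \<subseteq> ?V" "D \<subseteq> ?V" "card (?V - C) = card (?V - D)" using * by (simp_all add: mvc)
      then show "card C = card D" using compl[OF CD(1)] compl[OF CD(2)] by linarith
    qed
  qed
  then show ?thesis
    unfolding pure_complex_def face_dim_def
    using simplicial_complex_independence_complex[OF assms(1)] by simp
qed

section \<open>The independence complex as a complex of cyclic cliques\<close>

text \<open>The condition says that \<open>u\<close> and \<open>v\<close> are at distance at most \<open>d\<close> on the cycle \<open>0, \<dots>, n - 1\<close>:
  either along the segment between them or around the other way.\<close>

definition cyclic_cliques :: "nat \<Rightarrow> nat \<Rightarrow> nat set set" where
  "cyclic_cliques n d =
     {F. F \<subseteq> {..<n} \<and> (\<forall>u\<in>F. \<forall>v\<in>F. u < v \<longrightarrow> v - u \<le> d \<or> n - d \<le> v - u)}"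

lemma edges_within_circulant_graph: "edges_within (circulant_graph n S)"
  unfolding edges_within_def circulant_graph_def by fastforce

lemma circulant_edge_iff:
  assumes "u < v" "v < n"
  shows "{u, v} \<in> snd (circulant_graph n {d + 1..n div 2}) \<longleftrightarrow> d < v - u \<and> v - u < n - d"
proof -
  define S where "S = {d + 1..n div 2}"
  have eq: "nat \<bar>int u - int v\<bar> = v - u" "nat \<bar>int v - int u\<bar> = v - u" using assms by simp_all
  have "{u, v} \<in> snd (circulant_graph n S) \<longleftrightarrow> v - u \<in> S \<or> n - (v - u) \<in> S"
  proof
    assume "{u, v} \<in> snd (circulant_graph n S)"
    then obtain a b where ab: "{u, v} = {a, b}"
      "nat \<bar>int a - int b\<bar> \<in> S \<or> n - nat \<bar>int a - int b\<bar> \<in> S"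
      unfolding circulant_graph_def by auto
    from ab(1) have "(a = u \<and> b = v) \<or> (a = v \<and> b = u)" by (auto simp: doubleton_eq_iff)
    then show "v - u \<in> S \<or> n - (v - u) \<in> S" using ab(2) eq by auto
  next
    assume "v - u \<in> S \<or> n - (v - u) \<in> S"
    then have "nat \<bar>int u - int v\<bar> \<in> S \<or> n - nat \<bar>int u - int v\<bar> \<in> S" unfolding eq .
    moreover have "u < n" "u \<noteq> v" using assms by simp_all
    ultimately show "{u, v} \<in> snd (circulant_graph n S)"
      unfolding circulant_graph_def using assms(2) by auto
  qed
  also have "\<dots> \<longleftrightarrow> d < v - u \<and> v - u < n - d"
    using assms unfolding S_def atLeastAtMost_iff by linarith
  finally show ?thesis unfolding S_def .
qed

lemma independence_complex_circulant:
  "independence_complex (circulant_graph n {d + 1..n div 2}) = cyclic_cliques n d"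
proof -
  let ?E = "snd (circulant_graph n {d + 1..n div 2})"
  have "indep F ?E \<longleftrightarrow> (\<forall>u\<in>F. \<forall>v\<in>F. u < v \<longrightarrow> v - u \<le> d \<or> n - d \<le> v - u)" if F: "F \<subseteq> {..<n}" for F
  proof -
    have "indep F ?E \<longleftrightarrow> (\<forall>u\<in>F. \<forall>v\<in>F. u < v \<longrightarrow> {u, v} \<notin> ?E)"
    proof
      assume "indep F ?E"
      then show "\<forall>u\<in>F. \<forall>v\<in>F. u < v \<longrightarrow> {u, v} \<notin> ?E" unfolding indep_def by simp
    next
      assume *: "\<forall>u\<in>F. \<forall>v\<in>F. u < v \<longrightarrow> {u, v} \<notin> ?E"
      show "indep F ?E"
        unfolding indep_def
      proof (intro ballI impI)
        fix u v assume uv: "u \<in> F" "v \<in> F" "u \<noteq> v"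
        show "{u, v} \<notin> ?E"
        proof (cases "u < v")
          case True
          then show ?thesis using * uv by simp
        next
          case False
          then have "{v, u} \<notin> ?E" using * uv by simp
          then show ?thesis by (simp add: insert_commute)
        qed
      qed
    qed
    also have "\<dots> \<longleftrightarrow> (\<forall>u\<in>F. \<forall>v\<in>F. u < v \<longrightarrow> v - u \<le> d \<or> n - d \<le> v - u)"
    proof (intro ball_cong refl imp_cong)
      fix u v assume "v \<in> F" "u < v"
      then show "{u, v} \<notin> ?E \<longleftrightarrow> v - u \<le> d \<or> n - d \<le> v - u"
        using circulant_edge_iff[of u v n d] F by auto
    qed
    finally show ?thesis .
  qed
  moreover have "fst (circulant_graph n {d + 1..n div 2}) = {..<n}"
    by (auto simp: circulant_graph_def)
  ultimately show ?thesis
    unfolding independence_complex_def cyclic_cliques_def by auto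
qed

text \<open>The two facets are \<open>{0, \<dots>, d}\<close> and \<open>{0, \<dots>, r, d, 2 d}\<close> with \<open>r = 3 d - n\<close>. In the second
  one, the three vertices \<open>0\<close>, \<open>d\<close>, \<open>2 d\<close> wind around the cycle with gaps \<open>d\<close>, \<open>d\<close>, \<open>d - r\<close>;
  a further vertex within distance \<open>d\<close> of all three lies in \<open>[0, r]\<close> or \<open>[2 d - r, 2 d]\<close>, and
  having all of the first interval excludes all of the second except \<open>2 d\<close>. Its size
  \<open>r + 3\<close> is less than \<open>d + 1\<close> because \<open>n \<ge> 2 d + 3\<close>.\<close>

lemma cyclic_cliques_not_pure:
  assumes n: "2 * d + 3 \<le> n" "n \<le> 3 * d"
  shows "\<not> pure_complex (cyclic_cliques n d)"
proof
  assume pure: "pure_complex (cyclic_cliques n d)"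
  have long: "{..d} \<in> facets (cyclic_cliques n d)"
    unfolding facets_def
  proof (intro CollectI conjI ballI impI)
    show "{..d} \<in> cyclic_cliques n d" using n by (auto simp: cyclic_cliques_def)
    fix H assume H: "H \<in> cyclic_cliques n d" "{..d} \<subseteq> H"
    have "y \<le> d" if y: "y \<in> H" for y
    proof (rule ccontr)
      assume yd: "\<not> y \<le> d"
      have yn: "y < n" using H y by (auto simp: cyclic_cliques_def)
      \<comment> \<open>A vertex of \<open>{0, \<dots>, d}\<close> too far from \<open>y\<close>, both ways round.\<close>
      define a where "a = (if y \<le> n - d - 1 then 0 else y - (n - d - 1))"
      have a: "a \<in> H" "a < y" "d < y - a" "y - a < n - d" using yd yn n H(2) by (auto simp: a_def)
      then show False using H(1) y unfolding cyclic_cliques_def by force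
    qed
    then show "H = {..d}" using H(2) by auto
  qed
  define r where "r = 3 * d - n"
  let ?T = "{..r} \<union> {d, 2 * d}"
  have short: "?T \<in> facets (cyclic_cliques n d)"
    unfolding facets_def
  proof (intro CollectI conjI ballI impI)
    show "?T \<in> cyclic_cliques n d" using n by (auto simp: cyclic_cliques_def r_def)
    fix H assume H: "H \<in> cyclic_cliques n d" "?T \<subseteq> H"
    have clash: "u \<notin> H \<or> v \<notin> H" if "u < v" "d < v - u" "v - u < n - d" for u v
      using H(1) that unfolding cyclic_cliques_def by force
    have "y \<in> ?T" if y: "y \<in> H" for y
    proof (rule ccontr)
      assume yT: "y \<notin> ?T"
      have yn: "y < n" using H y by (auto simp: cyclic_cliques_def)
      have in_H: "d \<in> H" "2 * d \<in> H" "0 \<in> H" "\<And>a. a \<le> r \<Longrightarrow> a \<in> H" using H(2) by auto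
      consider "r < y" "y < d" | "d < y" "y < n - d" | "n - d \<le> y" "y < 2 * d" | "2 * d < y"
        using yT n by (auto simp: r_def) linarith+
      then show False
      proof cases
        case 1
        then have "d < 2 * d - y" "2 * d - y < n - d" using n unfolding r_def by linarith+
        then show False using clash[of y "2 * d"] y in_H(2) 1 by linarith
      next
        case 2
        then show False using clash[of 0 y] y in_H(3) by simp
      next
        case 3
        \<comment> \<open>The vertex of \<open>[0, r]\<close> at the least distance from \<open>y\<close> that exceeds \<open>d\<close>.\<close>
        define a where "a = y - (n - d - 1)"
        have "a \<le> r" "a < y" "d < y - a" "y - a < n - d"
          using 3 n unfolding a_def r_def by linarith+
        then show False using clash[of a y] y in_H(4) by blast
      next
        case 4
        then have "d < y - d" "y - d < n - d" using n yn by linarith+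
        then show False using clash[of d y] y in_H(1) 4 by linarith
      qed
    qed
    then show "H = ?T" using H(2) by blast
  qed
  have "card ?T = r + 3" using n by (subst card_Un_disjoint) (auto simp: r_def)
  moreover have "card ?T = card {..d}" using pure_complex_facet_card[OF pure short long] .
  ultimately show False using n by (simp add: r_def)
qed

section \<open>Vertex decomposable families\<close>

lemma vertex_decomposable_Pow:
  assumes "finite V"
  shows "vertex_decomposable (Pow V)"
proof (rule vertex_decomposable.simplex)
  have f: "facets (Pow V) = {V}" unfolding facets_def by blast
  then show "facets (Pow V) = {\<Union>(Pow V)}" by simp
  show "pure_complex (Pow V)"
  proof (rule pure_complexI)
    show "simplicial_complex (Pow V)"
      unfolding simplicial_complex_def using assms by (auto intro: finite_subset)
  qed (simp add: f)
qed

text \<open>For a fixed-point free involution \<open>\<sigma>\<close> of \<open>V\<close> this is the boundary of the cross-polytope with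
  antipodal map \<open>\<sigma>\<close>. An element of \<open>V\<close> may also have its antipode outside \<open>V\<close>; it is then a
  cone point, so that deleting a vertex stays within the family.\<close>

definition cross_polytope :: "('a \<Rightarrow> 'a) \<Rightarrow> 'a set \<Rightarrow> 'a set set" where
  "cross_polytope \<sigma> V = {F. F \<subseteq> V \<and> (\<forall>x\<in>F. \<sigma> x \<notin> F)}"

text \<open>A facet contains exactly one element of every orbit \<open>{x, \<sigma> x}\<close> that meets \<open>V\<close>.\<close>

lemma pure_cross_polytope:
  assumes "finite V" and \<sigma>: "\<And>x. x \<in> V \<Longrightarrow> \<sigma> x \<noteq> x \<and> \<sigma> (\<sigma> x) = x"
  shows "pure_complex (cross_polytope \<sigma> V)"
proof (rule pure_complexI)
  show "simplicial_complex (cross_polytope \<sigma> V)"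
    by (rule simplicial_complexI_subsets[OF assms(1)]) (auto simp: cross_polytope_def)
  fix F assume F: "F \<in> facets (cross_polytope \<sigma> V)"
  then have F': "F \<subseteq> V" "\<And>x. x \<in> F \<Longrightarrow> \<sigma> x \<notin> F" using facetsD[OF F] by (auto simp: cross_polytope_def)
  let ?q = "\<lambda>x. {x, \<sigma> x}"
  have "inj_on ?q F"
    using F'(2) by (auto simp: inj_on_def doubleton_eq_iff)
  moreover have "?q ` F = ?q ` V"
  proof (intro equalityI subsetI)
    fix p assume "p \<in> ?q ` V"
    then obtain x where x: "x \<in> V" "p = ?q x" by blast
    show "p \<in> ?q ` F"
    proof (cases "x \<in> F")
      case False
      then have "insert x F \<notin> cross_polytope \<sigma> V" using F unfolding facets_def by blast
      then have "\<exists>y\<in>insert x F. \<sigma> y \<in> insert x F" using F'(1) x(1) by (auto simp: cross_polytope_def)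
      then have "\<sigma> x \<in> F" using \<sigma> x(1) F' by (metis insert_iff subsetD)
      moreover have "?q (\<sigma> x) = p" using \<sigma>[OF x(1)] x(2) by auto
      ultimately show ?thesis by blast
    qed (use x in blast)
  qed (use F'(1) in blast)
  ultimately show "card F = card (?q ` V)" using card_image by metis
qed

text \<open>If \<open>x\<close> and \<open>\<sigma> x\<close> are both present, removing \<open>x\<close> leaves the same kind of complex on \<open>V - {x}\<close>, with
  \<open>\<sigma> x\<close> now a cone point, and the link of \<open>x\<close> is the one on \<open>V - {x, \<sigma> x}\<close>. When no
  antipodal pair is left, all of \<open>V\<close> is a face.\<close>

lemma vertex_decomposable_cross_polytope:
  assumes "finite V" and "\<And>x. x \<in> V \<Longrightarrow> \<sigma> x \<noteq> x \<and> \<sigma> (\<sigma> x) = x"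
  shows "vertex_decomposable (cross_polytope \<sigma> V)"
  using assms
proof (induction V rule: finite_psubset_induct)
  case (psubset V)
  show ?case
  proof (cases "\<exists>x\<in>V. \<sigma> x \<in> V")
    case False
    then have "cross_polytope \<sigma> V = Pow V" by (auto simp: cross_polytope_def)
    then show ?thesis using vertex_decomposable_Pow[OF psubset.hyps] by simp
  next
    case True
    then obtain x where x: "x \<in> V" "\<sigma> x \<in> V" by blast
    have \<sigma>: "\<sigma> y \<noteq> x" if "y \<in> V" "y \<noteq> \<sigma> x" for y using psubset.prems[OF that(1)] that(2) by metis
    have \<sigma>x: "\<sigma> x \<noteq> x" using psubset.prems[OF x(1)] by blast
    have "link (cross_polytope \<sigma> V) {x} = cross_polytope \<sigma> (V - {x, \<sigma> x})"
    proof (intro equalityI subsetI)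
      fix H assume "H \<in> link (cross_polytope \<sigma> V) {x}"
      then show "H \<in> cross_polytope \<sigma> (V - {x, \<sigma> x})" by (auto simp: link_def cross_polytope_def)
    next
      fix H assume H: "H \<in> cross_polytope \<sigma> (V - {x, \<sigma> x})"
      then have "\<sigma> y \<noteq> x" if "y \<in> H" for y using \<sigma>[of y] that by (auto simp: cross_polytope_def)
      then show "H \<in> link (cross_polytope \<sigma> V) {x}"
        using H x(1) \<sigma>x by (auto simp: link_def cross_polytope_def)
    qed
    moreover have "deletion (cross_polytope \<sigma> V) {x} = cross_polytope \<sigma> (V - {x})"
      by (auto simp: deletion_def cross_polytope_def)
    moreover have "vertex_decomposable (cross_polytope \<sigma> (V - {x, \<sigma> x}))"
      "vertex_decomposable (cross_polytope \<sigma> (V - {x}))"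
      by (rule psubset.IH; use x psubset.prems in blast)+
    moreover have "{x} \<in> cross_polytope \<sigma> V" using x \<sigma>x by (simp add: cross_polytope_def)
    then have "x \<in> \<Union>(cross_polytope \<sigma> V)" by blast
    moreover have "pure_complex (cross_polytope \<sigma> V)"
      by (rule pure_cross_polytope[OF psubset.hyps psubset.prems])
    ultimately show ?thesis using vertex_decomposable.vertex[of "cross_polytope \<sigma> V" x] by simp
  qed
qed

text \<open>The non-cyclic analogue of \<open>cyclic_cliques\<close>; for \<open>k = 1\<close> it is a path with \<open>m\<close> vertices.\<close>

definition window_complex :: "nat \<Rightarrow> nat \<Rightarrow> nat set set" where
  "window_complex m k = {F. F \<subseteq> {..<m} \<and> (\<forall>u\<in>F. \<forall>v\<in>F. v \<le> u + k)}"

lemma pure_window_complex: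
  assumes "k < m"
  shows "pure_complex (window_complex m k)"
proof (rule pure_complexI)
  show "simplicial_complex (window_complex m k)"
    by (rule simplicial_complexI_subsets[of "{..<m}"]) (auto simp: window_complex_def)
  fix F assume F: "F \<in> facets (window_complex m k)"
  have F': "F \<subseteq> {..<m}" "\<And>u v. u \<in> F \<Longrightarrow> v \<in> F \<Longrightarrow> v \<le> u + k"
    using facetsD[OF F] by (auto simp: window_complex_def)
  have max: "F = H" if "H \<in> window_complex m k" "F \<subseteq> H" for H
    using F that unfolding facets_def by blast
  have "F \<noteq> {}" using max[of "{0}"] assms by (auto simp: window_complex_def)
  moreover have "finite F" using F'(1) finite_subset by blast
  ultimately have a: "Min F \<in> F" "\<And>v. v \<in> F \<Longrightarrow> Min F \<le> v" by simp_all
  \<comment> \<open>The window starting at \<open>Min F\<close>, moved to the left if it would leave \<open>{..<m}\<close>.\<close>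
  define a where "a = min (Min F) (m - 1 - k)"
  have "F = {a..a + k}"
  proof (rule max)
    show "{a..a + k} \<in> window_complex m k" using assms by (auto simp: window_complex_def a_def)
    show "F \<subseteq> {a..a + k}"
    proof
      fix v assume v: "v \<in> F"
      have "v \<le> Min F + k" "Min F \<le> v" "v < m" using v a F' by auto
      then show "v \<in> {a..a + k}" by (auto simp: a_def min_def)
    qed
  qed
  then show "card F = k + 1" by simp
qed

text \<open>Shed the last vertex, whose link is the simplex on the \<open>k\<close> vertices before it, until at most
  \<open>k + 1\<close> vertices remain and all of them together are a face.\<close>

lemma vertex_decomposable_window_complex: "vertex_decomposable (window_complex m k)"
proof (induction m)
  case 0
  have "window_complex 0 k = Pow {}" by (auto simp: window_complex_def)
  then show ?case using vertex_decomposable_Pow[of "{}"] by simp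
next
  case (Suc m)
  show ?case
  proof (cases "m \<le> k")
    case True
    then have "window_complex (Suc m) k = Pow {..<Suc m}" by (fastforce simp: window_complex_def)
    then show ?thesis using vertex_decomposable_Pow[of "{..<Suc m}"] by simp
  next
    case False
    have "link (window_complex (Suc m) k) {m} = Pow {m - k..<m}"
    proof (intro equalityI subsetI)
      fix H assume "H \<in> link (window_complex (Suc m) k) {m}"
      then have H: "m \<notin> H" "H \<subseteq> {..<Suc m}" "\<forall>u\<in>H. m \<le> u + k"
        by (auto simp: link_def window_complex_def)
      show "H \<in> Pow {m - k..<m}"
      proof
        show "H \<subseteq> {m - k..<m}"
        proof
          fix u assume "u \<in> H"
          then have "u < Suc m" "u \<noteq> m" "m \<le> u + k" using H by auto
          then show "u \<in> {m - k..<m}" by auto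
        qed
      qed
    next
      fix H assume "H \<in> Pow {m - k..<m}"
      then have H: "\<And>u. u \<in> H \<Longrightarrow> m \<le> u + k \<and> u < m" by fastforce
      have "v \<le> u + k" if "u \<in> H" "v \<in> H" for u v using H[OF that(1)] H[OF that(2)] by linarith
      then show "H \<in> link (window_complex (Suc m) k) {m}"
        using H by (auto simp: link_def window_complex_def less_imp_le less_SucI trans_le_add1)
    qed
    moreover have "deletion (window_complex (Suc m) k) {m} = window_complex m k"
      by (auto simp: deletion_def window_complex_def less_Suc_eq)
    moreover have "{m} \<in> window_complex (Suc m) k" by (simp add: window_complex_def)
    then have "m \<in> \<Union>(window_complex (Suc m) k)" by blast
    moreover have "pure_complex (window_complex (Suc m) k)"
      using False by (intro pure_window_complex) simp
    ultimately show ?thesis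
      using Suc vertex_decomposable.vertex[of "window_complex (Suc m) k" m]
        vertex_decomposable_Pow[of "{m - k..<m}"]
      by simp
  qed
qed

lemma vertex_decomposable_cyclic_cliques_matching:
  "vertex_decomposable (cyclic_cliques (2 * d + 2) d)"
proof -
  define \<sigma> where "\<sigma> = (\<lambda>x. if x \<le> d then x + (d + 1) else x - (d + 1))"
  have "cyclic_cliques (2 * d + 2) d = cross_polytope \<sigma> {..<2 * d + 2}"
  proof (intro equalityI subsetI)
    fix F assume F: "F \<in> cyclic_cliques (2 * d + 2) d"
    have "\<sigma> x \<notin> F" if x: "x \<in> F" for x
    proof
      assume y: "\<sigma> x \<in> F"
      have clash: "v \<noteq> u + (d + 1)" if "u \<in> F" "v \<in> F" for u v
      proof
        assume v: "v = u + (d + 1)"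
        then have "u < v" by simp
        then have "v - u \<le> d \<or> 2 * d + 2 - d \<le> v - u"
          using F that unfolding cyclic_cliques_def by simp
        then show False using v by linarith
      qed
      show False
        using clash[OF x y] clash[OF y x] by (auto simp: \<sigma>_def split: if_splits)
    qed
    then show "F \<in> cross_polytope \<sigma> {..<2 * d + 2}"
      using F by (auto simp: cyclic_cliques_def cross_polytope_def)
  next
    fix F assume F: "F \<in> cross_polytope \<sigma> {..<2 * d + 2}"
    have "v - u \<noteq> d + 1" if "u \<in> F" "v \<in> F" "u < v" for u v
    proof
      assume "v - u = d + 1"
      moreover have "v < 2 * d + 2" using F that by (auto simp: cross_polytope_def)
      ultimately have "\<sigma> u = v" using that(3) by (auto simp: \<sigma>_def)
      then show False using F that by (auto simp: cross_polytope_def)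
    qed
    then show "F \<in> cyclic_cliques (2 * d + 2) d"
      using F unfolding cyclic_cliques_def cross_polytope_def by fastforce
  qed
  moreover have "vertex_decomposable (cross_polytope \<sigma> {..<2 * d + 2})"
    by (rule vertex_decomposable_cross_polytope) (auto simp: \<sigma>_def)
  ultimately show ?thesis by simp
qed

text \<open>Removing one vertex from a cycle leaves a path, and the link of the vertex consists of its two
  neighbours, which are not adjacent for \<open>n \<ge> 4\<close> and so form a cross-polytope of dimension 0.\<close>

lemma vertex_decomposable_cyclic_cliques_cycle:
  assumes n: "4 \<le> n" and pure: "pure_complex (cyclic_cliques n 1)"
  shows "vertex_decomposable (cyclic_cliques n 1)"
proof -
  define \<Delta> where "\<Delta> = cyclic_cliques n 1"
  obtain m where m: "n = m + 1" "3 \<le> m" using n that[of "n - 1"] by simp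
  have iff: "F \<in> \<Delta> \<longleftrightarrow>
    (\<forall>u\<in>F. u \<le> m) \<and> (\<forall>u\<in>F. \<forall>v\<in>F. u < v \<longrightarrow> v = u + 1 \<or> (u = 0 \<and> v = m))" for F
  proof (cases "\<forall>u\<in>F. u \<le> m")
    case True
    have "(v - u \<le> 1 \<or> n - 1 \<le> v - u) = (v = u + 1 \<or> (u = 0 \<and> v = m))"
      if "v \<in> F" "u < v" for u v
    proof -
      have "v \<le> m" using True that by blast
      then show ?thesis using that(2) m by linarith
    qed
    moreover have "F \<subseteq> {..<n}" using True m(1) by auto
    ultimately show ?thesis using True by (simp add: \<Delta>_def cyclic_cliques_def)
  next
    case False
    then show ?thesis using m(1) by (auto simp: \<Delta>_def cyclic_cliques_def)
  qed
  define \<sigma> where "\<sigma> = (\<lambda>x. m - 1 - x)"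
  have "link \<Delta> {m} = cross_polytope \<sigma> {0, m - 1}"
  proof (intro equalityI subsetI)
    fix H assume "H \<in> link \<Delta> {m}"
    then have H: "m \<notin> H" "H \<in> \<Delta>" "insert m H \<in> \<Delta>"
      by (auto simp: link_def)
    have ends: "u = 0 \<or> u = m - 1" if "u \<in> H" for u
    proof -
      have "u \<le> m" "u \<noteq> m" using H(1,2) that unfolding iff by auto
      then have "u < m" by simp
      then have "m = u + 1 \<or> u = 0" using H(3) that unfolding iff by simp
      then show ?thesis by linarith
    qed
    have one: "\<not> (0 \<in> H \<and> m - 1 \<in> H)"
    proof
      assume "0 \<in> H \<and> m - 1 \<in> H"
      moreover have "0 < m - 1" using m(2) by simp
      ultimately have "m - 1 = 0 + 1 \<or> m - 1 = m" using H(2) unfolding iff by blast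
      then show False using m(2) by linarith
    qed
    have "\<sigma> u \<notin> H" if "u \<in> H" for u
      using ends[OF that] one that by (auto simp: \<sigma>_def)
    then show "H \<in> cross_polytope \<sigma> {0, m - 1}"
      using ends by (auto simp: cross_polytope_def)
  next
    fix H assume "H \<in> cross_polytope \<sigma> {0, m - 1}"
    then have H: "H \<subseteq> {0, m - 1}" "0 \<in> H \<Longrightarrow> m - 1 \<notin> H"
      by (auto simp: cross_polytope_def \<sigma>_def)
    have "H = {} \<or> H = {0} \<or> H = {m - 1}" using H by auto
    then show "H \<in> link \<Delta> {m}"
      using m(2) unfolding link_def iff by auto
  qed
  moreover have "vertex_decomposable (cross_polytope \<sigma> {0, m - 1})"
    by (rule vertex_decomposable_cross_polytope) (use m(2) in \<open>auto simp: \<sigma>_def\<close>)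
  moreover have "deletion \<Delta> {m} = window_complex m 1"
  proof (intro equalityI subsetI)
    fix H assume "H \<in> deletion \<Delta> {m}"
    then have H: "m \<notin> H" "H \<in> \<Delta>" by (auto simp: deletion_def)
    have lt: "u < m" if "u \<in> H" for u
    proof -
      have "u \<le> m" "u \<noteq> m" using H that unfolding iff by auto
      then show ?thesis by simp
    qed
    have "v \<le> u + 1" if "u \<in> H" "v \<in> H" for u v
    proof (cases "u < v")
      case True
      then have "v = u + 1 \<or> (u = 0 \<and> v = m)" using H(2) that unfolding iff by blast
      then show ?thesis using lt[OF that(2)] by linarith
    qed simp
    then show "H \<in> window_complex m 1" using lt by (auto simp: window_complex_def)
  next
    fix H assume H: "H \<in> window_complex m 1"
    have "v = u + 1" if "u \<in> H" "v \<in> H" "u < v" for u v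
    proof -
      have "v \<le> u + 1" using H that unfolding window_complex_def by blast
      then show ?thesis using that(3) by linarith
    qed
    moreover have "u < m" if "u \<in> H" for u
      using H that unfolding window_complex_def by auto
    ultimately show "H \<in> deletion \<Delta> {m}"
      unfolding deletion_def iff by (auto simp: less_imp_le)
  qed
  moreover have "{m} \<in> \<Delta>" unfolding iff by simp
  then have "m \<in> \<Union>\<Delta>" by blast
  moreover have "pure_complex \<Delta>" using pure by (simp add: \<Delta>_def)
  ultimately have "vertex_decomposable \<Delta>"
    using vertex_decomposable.vertex[of \<Delta> m] vertex_decomposable_window_complex[of m 1]
    by simp
  then show ?thesis by (simp add: \<Delta>_def)
qed

section \<open>Arcs as the facets for large cycles\<close>

lemma mod_eq_representative:
  "0 \<le> w \<Longrightarrow> w < n \<Longrightarrow> t = w + n * k \<Longrightarrow> t mod n = w" for t w n k :: int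
  by simp

text \<open>The \<open>d + 1\<close> consecutive vertices that start at \<open>a\<close>. The start is an integer modulo \<open>n\<close>, which
  spares distinguishing the arcs that pass through \<open>0\<close>.\<close>

definition arc :: "nat \<Rightarrow> nat \<Rightarrow> int \<Rightarrow> nat set" where
  "arc n d a = {v. v < n \<and> (int v - a) mod int n \<le> int d}"

lemma arc_mod: "arc n d (a mod int n) = arc n d a"
  by (simp add: arc_def mod_diff_right_eq)

lemma arc_in_cyclic_cliques: "arc n d a \<in> cyclic_cliques n d"
proof -
  have "v - u \<le> d \<or> n - d \<le> v - u" if uv: "u \<in> arc n d a" "v \<in> arc n d a" "u < v" for u v
  proof (cases "d < n")
    case True
    define s t where "s = (int u - a) mod int n" and "t = (int v - a) mod int n"
    have vn: "v < n" using uv by (simp add: arc_def)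
    have st: "0 \<le> s" "s \<le> int d" "0 \<le> t" "t \<le> int d"
      using uv vn by (auto simp: arc_def s_def t_def)
    have "(t - s) mod int n = (int v - int u) mod int n"
      unfolding s_def t_def by (simp add: mod_diff_eq)
    also have "\<dots> = int v - int u" using uv(3) vn by simp
    finally have eq: "(t - s) mod int n = int v - int u" .
    show ?thesis
    proof (cases "s \<le> t")
      case True
      then have "(t - s) mod int n = t - s" using st \<open>d < n\<close> by simp
      then show ?thesis using eq st by linarith
    next
      case False
      have "(t - s) mod int n = t - s + int n"
        by (rule mod_eq_representative[of _ _ _ "-1"]) (use False st \<open>d < n\<close> in linarith)+
      then show ?thesis using eq st by linarith
    qed
  next
    case False
    then show ?thesis using uv by (auto simp: arc_def)
  qed
  then show ?thesis unfolding cyclic_cliques_def by (auto simp: arc_def)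
qed

text \<open>Fix \<open>x\<close> in the clique and unroll the cycle around it: every other member \<open>y\<close> has an offset
  \<open>off y\<close> in \<open>[-d, d]\<close> from \<open>x\<close>. Two offsets differ by at most \<open>2 d < n - d\<close>, so their difference
  cannot be realised by going around the other way and is at most \<open>d\<close>. Hence the whole
  clique lies in the arc that starts at the member with the least offset.\<close>

lemma cyclic_clique_subset_arc:
  assumes n: "3 * d < n" and F: "F \<in> cyclic_cliques n d" "F \<noteq> {}"
  obtains a where "F \<subseteq> arc n d a"
proof -
  have Fn: "\<And>y. y \<in> F \<Longrightarrow> y < n" and FF: "F \<subseteq> {..<n}" using F by (auto simp: cyclic_cliques_def)
  have near: "v - u \<le> d \<or> n - d \<le> v - u" if "u \<in> F" "v \<in> F" "u < v" for u v
    using F that by (auto simp: cyclic_cliques_def)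
  obtain x where x: "x \<in> F" using F by blast
  define off where "off = (\<lambda>y. (int y - int x + int d) mod int n - int d)"
  have off_lower: "- int d \<le> off y" for y
    using n by (simp add: off_def)
  have off_upper: "off y \<le> int d" if y: "y \<in> F" for y
  proof -
    have lt: "x < n" "y < n" using Fn x y by blast+
    consider "\<bar>int y - int x\<bar> \<le> int d" | "x < y" "n - d \<le> y - x" | "y < x" "n - d \<le> x - y"
      using near[OF x y] near[OF y x] by linarith
    then show ?thesis
    proof cases
      case 1
      have "(int y - int x + int d) mod int n = int y - int x + int d"
        by (rule mod_eq_representative[of _ _ _ 0]) (use 1 n in linarith)+
      then show ?thesis using 1 by (simp add: off_def)
    next
      case 2
      have "(int y - int x + int d) mod int n = int y - int x + int d - int n"
        by (rule mod_eq_representative[of _ _ _ 1]) (use 2 n lt in linarith)+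
      then show ?thesis using 2 lt unfolding off_def by linarith
    next
      case 3
      have "(int y - int x + int d) mod int n = int y - int x + int d + int n"
        by (rule mod_eq_representative[of _ _ _ "-1"]) (use 3 n lt in linarith)+
      then show ?thesis using 3 n lt unfolding off_def by linarith
    qed
  qed
  have "finite F" using FF finite_subset by blast
  then have fin: "finite (off ` F)" "off ` F \<noteq> {}" using F(2) by auto
  obtain z where z: "z \<in> F" "off z = Min (off ` F)" using Min_in[OF fin] by auto
  have "y \<in> arc n d (int z)" if y: "y \<in> F" for y
  proof -
    define w where "w = off y - off z"
    have "off z \<le> off y" using z(2) Min_le[OF fin(1), of "off y"] y by simp
    then have w: "0 \<le> w" "w \<le> 2 * int d"
      using off_upper[OF y] off_lower[of z] by (simp_all add: w_def)
    define q where "q = (\<lambda>v. (int v - int x + int d) div int n)"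
    have off: "off v = int v - int x - int n * q v" for v
      unfolding off_def q_def by (simp add: minus_mult_div_eq_mod[symmetric])
    have mod: "(int y - int z) mod int n = w"
      by (rule mod_eq_representative[of _ _ _ "q y - q z"])
        (use w n in \<open>simp_all add: w_def off right_diff_distrib\<close>)
    have lt: "y < n" "z < n" using Fn y z(1) by blast+
    have "w \<le> int d"
    proof -
      consider "y = z" | "z < y" | "y < z" by linarith
      then show ?thesis
      proof cases
        case 1
        then show ?thesis using mod by simp
      next
        case 2
        then have "w = int y - int z" using mod lt by simp
        then show ?thesis using near[OF z(1) y 2] 2 w n by linarith
      next
        case 3
        have "(int y - int z) mod int n = int y - int z + int n"
          by (rule mod_eq_representative[of _ _ _ "-1"]) (use 3 lt in linarith)+
        then have "w = int y - int z + int n" using mod by simp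
        then show ?thesis using near[OF y z(1) 3] 3 w n by linarith
      qed
    qed
    then show ?thesis using lt mod by (simp add: arc_def)
  qed
  then show thesis using that by blast
qed

lemma card_arc:
  assumes "d < n"
  shows "card (arc n d a) = d + 1"
proof -
  define f where "f = (\<lambda>j. nat ((a + int j) mod int n))"
  define g where "g = (\<lambda>v. nat ((int v - a) mod int n))"
  have pos: "0 < int n" using assms by simp
  have fint: "int (f j) = (a + int j) mod int n" for j using pos by (simp add: f_def)
  have gint: "int (g v) = (int v - a) mod int n" for v using pos by (simp add: g_def)
  have offset: "(int (f j) - a) mod int n = int j" if "j \<le> d" for j
  proof -
    have "(int (f j) - a) mod int n = (a + int j - a) mod int n" unfolding fint by (rule mod_diff_left_eq)
    also have "\<dots> = int j" using that assms by simp
    finally show ?thesis .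
  qed
  have "bij_betw f {..d} (arc n d a)"
  proof (rule bij_betw_byWitness[of _ g])
    show "\<forall>j\<in>{..d}. g (f j) = j"
    proof
      fix j assume "j \<in> {..d}"
      then have "int (g (f j)) = int j" unfolding gint using offset by simp
      then show "g (f j) = j" by (simp only: of_nat_eq_iff)
    qed
    show "\<forall>v\<in>arc n d a. f (g v) = v"
    proof
      fix v assume "v \<in> arc n d a"
      then have "v < n" by (simp add: arc_def)
      have "int (f (g v)) = (a + (int v - a)) mod int n" unfolding fint gint by (rule mod_add_right_eq)
      also have "\<dots> = int v" using \<open>v < n\<close> by simp
      finally show "f (g v) = v" by (simp only: of_nat_eq_iff)
    qed
    show "f ` {..d} \<subseteq> arc n d a"
    proof (rule image_subsetI)
      fix j assume j: "j \<in> {..d}"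
      have "int (f j) < int n" unfolding fint using pos by simp
      then show "f j \<in> arc n d a" using offset[of j] j by (simp add: arc_def)
    qed
    show "g ` arc n d a \<subseteq> {..d}" by (auto simp: arc_def g_def)
  qed
  then show ?thesis using bij_betw_same_card by fastforce
qed

lemma simplicial_complex_cyclic_cliques: "simplicial_complex (cyclic_cliques n d)"
  by (rule simplicial_complexI_subsets[of "{..<n}"]) (auto simp: cyclic_cliques_def)

lemma facets_cyclic_cliques:
  assumes n: "3 * d < n"
  shows "facets (cyclic_cliques n d) = range (arc n d)"
proof (intro equalityI subsetI)
  have dn: "d < n" using n by simp
  {
    fix F assume F: "F \<in> facets (cyclic_cliques n d)"
    have "{0} \<in> cyclic_cliques n d" using n by (simp add: cyclic_cliques_def)
    then have "F \<noteq> {}" using F unfolding facets_def by blast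
    then obtain a where "F \<subseteq> arc n d a" using cyclic_clique_subset_arc[OF n facetsD[OF F]] by blast
    then have "arc n d a = F" using F arc_in_cyclic_cliques unfolding facets_def by blast
    then show "F \<in> range (arc n d)" by blast
  next
    fix F assume "F \<in> range (arc n d)"
    then obtain a where a: "F = arc n d a" by blast
    have "H = F" if H: "H \<in> cyclic_cliques n d" "F \<subseteq> H" for H
    proof -
      have "F \<noteq> {}" using card_arc[OF dn, of a] a by auto
      then have "H \<noteq> {}" using H(2) by blast
      then obtain b where b: "H \<subseteq> arc n d b" using cyclic_clique_subset_arc[OF n H(1)] by blast
      have "finite (arc n d b)" by (simp add: arc_def)
      moreover have "F \<subseteq> arc n d b" using H(2) b by blast
      ultimately have "F = arc n d b" using card_arc[OF dn] a by (metis card_subset_eq)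
      then show ?thesis using H(2) b by blast
    qed
    then show "F \<in> facets (cyclic_cliques n d)"
      using a arc_in_cyclic_cliques unfolding facets_def by blast
  }
qed

lemma pure_cyclic_cliques:
  assumes n: "3 * d < n"
  shows "pure_complex (cyclic_cliques n d)"
proof (rule pure_complexI[OF simplicial_complex_cyclic_cliques])
  fix F assume "F \<in> facets (cyclic_cliques n d)"
  then obtain a where "F = arc n d a" unfolding facets_cyclic_cliques[OF n] by blast
  then show "card F = d + 1" using card_arc[of d n a] n by simp
qed

text \<open>Take the arcs through \<open>x\<close> in the order of their starting points \<open>x - d, \<dots>, x\<close>. The arc \<open>A i\<close>
  adds one vertex \<open>z i\<close> to its predecessor, and this vertex lies in no earlier arc
  because \<open>2 d < n\<close>. Consequently \<open>z i\<close> witnesses the shelling condition against all earlier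
  arcs at once.\<close>

lemma shellable_link_cyclic_cliques:
  assumes n: "3 * d < n" and x: "x < n"
  shows "shellable (link (cyclic_cliques n d) {x})"
proof -
  let ?\<Delta> = "cyclic_cliques n d"
  define A where "A = (\<lambda>i. arc n d (int x - int d + int i) - {x})"
  define Fs where "Fs = map A [0..<d + 1]"
  have nth: "Fs ! i = A i" if "i \<le> d" for i using that by (simp add: Fs_def del: upt_Suc)
  have len: "length Fs = d + 1" by (simp add: Fs_def)
  define z where "z = (\<lambda>i. nat ((int x + int i) mod int n))"
  have z: "int (z i) = (int x + int i) mod int n" for i using n by (simp add: z_def)
  have z_lt: "z i < n" for i
  proof -
    have "int (z i) < int n" unfolding z using n by simp
    then show ?thesis by simp
  qed
  have z_offset: "(int (z i) - (int x - int d + int j)) mod int n = int d + int i - int j"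
    if "i \<le> d" "j \<le> d" for i j
  proof -
    have "(int (z i) - (int x - int d + int j)) mod int n
        = (int x + int i - (int x - int d + int j)) mod int n"
      unfolding z by (rule mod_diff_left_eq)
    also have "\<dots> = int d + int i - int j"
      by (rule mod_eq_representative[of _ _ _ 0]) (use that n in linarith)+
    finally show ?thesis .
  qed
  have z_in: "z i \<in> A i" if "0 < i" "i \<le> d" for i
  proof -
    have "z i \<noteq> x"
    proof
      assume "z i = x"
      then have "(int x + int i - int x) mod int n = (int x - int x) mod int n"
        using z[of i] by (metis mod_diff_left_eq)
      then show False using that n by simp
    qed
    then show ?thesis using z_offset[of i i] z_lt that by (simp add: A_def arc_def)
  qed
  have z_notin: "z i \<notin> A j" if "j < i" "i \<le> d" for i j
    using z_offset[of i j] that by (simp add: A_def arc_def)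
  have step: "A i - A (i - 1) = {z i}" if i: "0 < i" "i \<le> d" for i
  proof (intro equalityI subsetI)
    fix v assume v: "v \<in> A i - A (i - 1)"
    define a where "a = int x - int d + int i"
    have vn: "v < n" "v \<noteq> x" using v by (auto simp: A_def arc_def)
    have eq: "int x - int d + int (i - 1) = a - 1" using i by (simp add: a_def)
    define t where "t = (int v - a) mod int n"
    have t: "0 \<le> t" "t \<le> int d" using v n by (auto simp: t_def A_def arc_def a_def)
    have far: "int d < (int v - (a - 1)) mod int n"
      using v vn unfolding A_def arc_def eq by auto
    have "(int v - (a - 1)) mod int n = (t + 1) mod int n"
    proof -
      have "int v - (a - 1) = int v - a + 1" by simp
      then show ?thesis unfolding t_def by (simp only: mod_add_left_eq)
    qed
    also have "\<dots> = t + 1" using t n i by simp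
    finally have "t = int d" using far t by linarith
    then have "(a + t) mod int n = int (z i)" by (simp add: z a_def add.commute)
    moreover have "(a + t) mod int n = int v mod int n"
      unfolding t_def by (simp add: mod_add_right_eq)
    ultimately have "v = z i" using vn by simp
    then show "v \<in> {z i}" by simp
  next
    fix v assume "v \<in> {z i}"
    then show "v \<in> A i - A (i - 1)" using z_in[OF i] z_notin[of "i - 1" i] i by simp
  qed
  have "shelling Fs"
    unfolding shelling_def
  proof (intro allI impI)
    fix i j assume ij: "i < length Fs" "j < i"
    then have i: "0 < i" "i \<le> d" "j \<le> d" "i - 1 \<le> d" by (auto simp: len)
    have "z i \<in> Fs ! i - Fs ! j" using z_in[OF i(1,2)] z_notin[OF ij(2) i(2)] by (simp add: nth i)
    moreover have "Fs ! i - Fs ! (i - 1) = {z i}" unfolding nth[OF i(2)] nth[OF i(4)] by (rule step[OF i(1,2)])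
    moreover have "i - 1 < i" using i by simp
    ultimately show "\<exists>x\<in>Fs ! i - Fs ! j. \<exists>l<i. Fs ! i - Fs ! l = {x}" by blast
  qed
  moreover have "distinct Fs"
    unfolding distinct_conv_nth
  proof (intro allI impI)
    have neq: "Fs ! i \<noteq> Fs ! j" if "j < i" "i \<le> d" for i j
      using z_in[of i] z_notin[OF that] that by (auto simp: nth)
    fix i j assume "i < length Fs" "j < length Fs" "i \<noteq> j"
    then show "Fs ! i \<noteq> Fs ! j" using neq[of i j] neq[of j i] unfolding len by (cases "i < j") auto
  qed
  moreover have "set Fs = facets (link ?\<Delta> {x})"
    unfolding facets_link_vertex[OF simplicial_complex_cyclic_cliques] facets_cyclic_cliques[OF n]
  proof (intro equalityI subsetI)
    fix B assume "B \<in> set Fs"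
    then obtain i where i: "i \<le> d" "B = A i" by (auto simp: Fs_def less_Suc_eq_le simp del: upt_Suc)
    have "(int x - (int x - int d + int i)) mod int n = int d - int i"
      by (rule mod_eq_representative[of _ _ _ 0]) (use i n in linarith)+
    then have "x \<in> arc n d (int x - int d + int i)" using x by (simp add: arc_def)
    then show "B \<in> (\<lambda>F. F - {x}) ` {F \<in> range (arc n d). x \<in> F}"
      unfolding i(2) A_def by blast
  next
    fix B assume "B \<in> (\<lambda>F. F - {x}) ` {F \<in> range (arc n d). x \<in> F}"
    then obtain a where a: "x \<in> arc n d a" "B = arc n d a - {x}" by blast
    define t where "t = (int x - a) mod int n"
    have t: "0 \<le> t" "t \<le> int d" using a(1) n by (auto simp: t_def arc_def)
    have "(int x - t) mod int n = a mod int n"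
      unfolding t_def by (simp add: mod_diff_right_eq)
    then have "arc n d (int x - t) = arc n d a" by (metis arc_mod)
    moreover define i where "i = nat (int d - t)"
    then have i: "i \<le> d" "int x - int d + int i = int x - t" using t by auto
    ultimately have "B = A i" unfolding A_def using a(2) by (simp only:)
    then show "B \<in> set Fs" using i(1) by (auto simp: Fs_def simp del: upt_Suc)
  qed
  moreover have "pure_complex (link ?\<Delta> {x})"
    by (rule pure_complex_link_vertex[OF pure_cyclic_cliques[OF n]])
  ultimately show ?thesis unfolding shellable_iff by blast
qed

lemma buchsbaum_cyclic_cliques:
  assumes n: "3 * d < n"
  shows "buchsbaum TYPE('k::field) (cyclic_cliques n d)"
  unfolding buchsbaum_def
proof (intro conjI ballI)
  fix x assume "x \<in> \<Union>(cyclic_cliques n d)"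
  then have "x < n" by (auto simp: cyclic_cliques_def)
  then show "cohen_macaulay TYPE('k) (link (cyclic_cliques n d) {x})"
    by (intro shellable_imp_cohen_macaulay shellable_link_cyclic_cliques[OF n])
qed (rule pure_cyclic_cliques[OF n])

section \<open>The loop around the cycle does not bound\<close>

text \<open>The boundary operator is the transpose of the coboundary operator with respect to the pairing of
  functions on faces: both sides sum over the pairs of a face \<open>T\<close> and a vertex \<open>v\<close> of it.\<close>

lemma cocycle_annihilates_boundary:
  fixes e w :: "'a::linorder set \<Rightarrow> 'k::field"
  assumes V: "finite V" "\<Union>\<Delta> \<subseteq> V" and e: "e \<in> simplicial_chains \<Delta> i"
    and cocycle: "\<And>T. T \<in> \<Delta> \<Longrightarrow> face_dim T = i \<Longrightarrow>
      (\<Sum>v\<in>T. incidence_sign (T - {v}) v * w (T - {v})) = 0"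
  shows "(\<Sum>E\<in>Pow V. w E * boundary \<Delta> e E) = 0"
proof -
  have "(\<Sum>E\<in>Pow V. w E * boundary \<Delta> e E)
      = (\<Sum>E\<in>Pow V. \<Sum>v\<in>V - E. w E * (incidence_sign E v * e (insert v E)))"
    by (simp add: boundary_eq_ambient_boundary[OF V e] ambient_boundary_def sum_distrib_left)
  also have "\<dots> = (\<Sum>(E, v)\<in>(SIGMA E:Pow V. V - E). w E * (incidence_sign E v * e (insert v E)))"
    using V(1) by (intro sum.Sigma) auto
  also have "\<dots> = (\<Sum>(T, v)\<in>(SIGMA T:Pow V. T). e T * (incidence_sign (T - {v}) v * w (T - {v})))"
    by (rule sum.reindex_bij_witness[of _ "\<lambda>(T, v). (T - {v}, v)" "\<lambda>(E, v). (insert v E, v)"])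
      (auto simp: insert_absorb mult_ac)
  also have "\<dots> = (\<Sum>T\<in>Pow V. \<Sum>v\<in>T. e T * (incidence_sign (T - {v}) v * w (T - {v})))"
    using V(1) by (intro sum.Sigma[symmetric]) (auto intro: finite_subset)
  also have "\<dots> = (\<Sum>T\<in>Pow V. e T * (\<Sum>v\<in>T. incidence_sign (T - {v}) v * w (T - {v})))"
    by (simp add: sum_distrib_left)
  also have "\<dots> = 0"
  proof (rule sum.neutral, rule ballI)
    fix T
    show "e T * (\<Sum>v\<in>T. incidence_sign (T - {v}) v * w (T - {v})) = 0"
      using simplicial_chainsD[OF e, of T] cocycle[of T] by (cases "e T = 0") simp_all
  qed
  finally show ?thesis .
qed

text \<open>The loop \<open>0 \<rightarrow> 1 \<rightarrow> \<dots> \<rightarrow> n - 1 \<rightarrow> 0\<close>. As edges are oriented from the smaller to the larger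
  vertex, only its last edge has a negative coefficient.\<close>

definition round_cycle :: "nat \<Rightarrow> nat set \<Rightarrow> 'k::field" where
  "round_cycle n E =
     (if \<exists>u. u + 1 < n \<and> E = {u, u + 1} then 1 else if E = {0, n - 1} then - 1 else 0)"

text \<open>On an edge of \<open>cyclic_cliques n d\<close> this is 1 iff its short way round passes between \<open>n - 1\<close> and
  \<open>0\<close>, which happens iff the endpoints differ by more than \<open>d\<close>.\<close>

definition crossing :: "nat \<Rightarrow> nat set \<Rightarrow> 'k::field" where
  "crossing d E = (if \<exists>a\<in>E. \<exists>b\<in>E. a + d < b then 1 else 0)"

lemma round_cycle_pair:
  assumes "u < v" "v < n" "3 \<le> n"
  shows "round_cycle n {u, v} = (if v = u + 1 then 1 else if u = 0 \<and> v = n - 1 then - 1 else 0)"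
proof -
  have "(\<exists>w. w + 1 < n \<and> {u, v} = {w, w + 1}) \<longleftrightarrow> v = u + 1"
    using assms by (auto simp: doubleton_eq_iff)
  moreover have "{u, v} = {0, n - 1} \<longleftrightarrow> u = 0 \<and> v = n - 1"
    using assms by (auto simp: doubleton_eq_iff)
  ultimately show ?thesis by (simp only: round_cycle_def)
qed

lemma round_cycle_in_chains:
  assumes "1 \<le> d" "3 \<le> n"
  shows "round_cycle n \<in> simplicial_chains (cyclic_cliques n d) 1"
  unfolding simplicial_chains_def
proof (intro CollectI allI impI)
  fix E assume "round_cycle n E \<noteq> (0::'k::field)"
  then consider u where "u + 1 < n" "E = {u, u + 1}" | "E = {0, n - 1}"
    by (auto simp: round_cycle_def split: if_splits)
  then show "E \<in> cyclic_cliques n d \<and> face_dim E = 1"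
  proof cases
    case 1
    then show ?thesis using assms by (auto simp: cyclic_cliques_def face_dim_def)
  next
    case 2
    then show ?thesis using assms by (auto simp: cyclic_cliques_def face_dim_def)
  qed
qed

lemma round_cycle_in_cycles:
  assumes d: "1 \<le> d" and n: "3 \<le> n"
  shows "(round_cycle n :: nat set \<Rightarrow> 'k::field) \<in> simplicial_cycles (cyclic_cliques n d) 1"
proof -
  let ?\<Delta> = "cyclic_cliques n d" and ?c = "round_cycle n :: nat set \<Rightarrow> 'k"
  note chain = round_cycle_in_chains[OF d n]
  have V: "finite {..<n}" "\<Union>?\<Delta> \<subseteq> {..<n}" by (auto simp: cyclic_cliques_def)
  have bd0: "boundary ?\<Delta> ?c \<in> simplicial_chains ?\<Delta> 0"
    using boundary_in_simplicial_chains[OF simplicial_complex_cyclic_cliques, of _ _ _ 0] chain by simp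
  have vertex: "boundary ?\<Delta> ?c {a} = 0" if a: "a < n" for a
  proof -
    \<comment> \<open>The two edges at \<open>a\<close>; the last two terms account for \<open>{0, n - 1}\<close>.\<close>
    have summand: "incidence_sign {a} v * ?c (insert v {a}) =
        (if v = a + 1 then - 1 else 0) + (if v = a - 1 then (if a = 0 then 0 else 1) else 0)
        + (if v = n - 1 then (if a = 0 then 1 else 0) else 0)
        + (if v = 0 then (if a = n - 1 then - 1 else 0) else 0)" if v: "v \<in> {..<n} - {a}" for v
    proof (cases "a < v")
      case True
      have "{u \<in> {a}. u < v} = {a}" using True by auto
      then have "incidence_sign {a} v = (- 1 :: 'k)" by (simp add: incidence_sign_def)
      moreover have "?c (insert v {a}) = (if v = a + 1 then 1 else if a = 0 \<and> v = n - 1 then - 1 else 0)"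
        using round_cycle_pair[of a v n] True v n by (simp add: insert_commute)
      ultimately show ?thesis using True n by auto
    next
      case False
      then have va: "v < a" using v by auto
      have below: "{u \<in> {a}. u < v} = {}" using va by auto
      have "incidence_sign {a} v = (1 :: 'k)" unfolding incidence_sign_def below by simp
      moreover have "?c (insert v {a}) = (if a = v + 1 then 1 else if v = 0 \<and> a = n - 1 then - 1 else 0)"
        using round_cycle_pair[of v a n] va a n by simp
      ultimately show ?thesis using va n a by auto
    qed
    have "boundary ?\<Delta> ?c {a} = (\<Sum>v\<in>{..<n} - {a}. incidence_sign {a} v * ?c (insert v {a}))"
      by (simp add: boundary_eq_ambient_boundary[OF V chain] ambient_boundary_def)
    also have "\<dots> = (\<Sum>v\<in>{..<n} - {a}.
        (if v = a + 1 then - 1 else 0) + (if v = a - 1 then (if a = 0 then 0 else 1) else 0)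
        + (if v = n - 1 then (if a = 0 then 1 else 0) else 0)
        + (if v = 0 then (if a = n - 1 then - 1 else 0) else 0))"
      by (rule sum.cong[OF refl summand])
    also have "\<dots> = 0"
      unfolding sum.distrib using a n by (auto simp: sum.delta)
    finally show ?thesis .
  qed
  have "boundary ?\<Delta> ?c H = 0" for H
  proof (rule ccontr)
    assume nz: "boundary ?\<Delta> ?c H \<noteq> 0"
    then have H: "H \<in> ?\<Delta>" "face_dim H = 0" using simplicial_chainsD[OF bd0] by blast+
    then obtain a where "H = {a}" by (auto simp: face_dim_def card_1_singleton_iff)
    moreover have "H \<subseteq> {..<n}" using H(1) by (simp add: cyclic_cliques_def)
    ultimately show False using vertex[of a] nz by simp
  qed
  then have "boundary ?\<Delta> ?c = (\<lambda>_. 0)" by (rule ext)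
  then show ?thesis using chain unfolding simplicial_cycles_def by blast
qed

lemma crossing_pair: "a < b \<Longrightarrow> crossing d {a, b} = (if a + d < b then 1 else 0)"
  by (auto simp: crossing_def)

text \<open>Let \<open>x < y < z\<close> be the vertices of a triangle. As \<open>n > 3 d\<close>, it does not wind around the
  cycle: if the edge \<open>xz\<close> crosses, then exactly one of \<open>xy\<close> and \<open>yz\<close> does, and otherwise neither
  does.\<close>

lemma crossing_cocycle:
  assumes n: "3 * d < n" and T: "T \<in> cyclic_cliques n d" "face_dim T = 2"
  shows "(\<Sum>v\<in>T. incidence_sign (T - {v}) v * crossing d (T - {v})) = (0 :: 'k::field)"
proof -
  have Tn: "T \<subseteq> {..<n}" using T(1) by (simp add: cyclic_cliques_def)
  then have "T \<in> nsets {..<n} 3"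
    using T(2) finite_subset by (auto simp: nsets_def face_dim_def)
  then obtain x y z where xyz: "T = {x, y, z}" "x < y" "y < z"
    unfolding ordered_nsets_3_eq by blast
  have zn: "z < n" using Tn xyz(1) by blast
  have near: "v \<le> u + d \<or> n + u \<le> v + d" if "u \<in> T" "v \<in> T" "u < v" for u v
  proof -
    have "v - u \<le> d \<or> n - d \<le> v - u" using T(1) that unfolding cyclic_cliques_def by blast
    then show ?thesis using that(3) by linarith
  qed
  have xy: "y \<le> x + d \<or> n + x \<le> y + d" and yz: "z \<le> y + d \<or> n + y \<le> z + d"
    and xz: "z \<le> x + d \<or> n + x \<le> z + d"
    using near xyz by auto
  have diffs: "T - {x} = {y, z}" "T - {y} = {x, z}" "T - {z} = {x, y}" using xyz by auto
  have below: "{u \<in> {y, z}. u < x} = {}" "{u \<in> {x, z}. u < y} = {x}" "{u \<in> {x, y}. u < z} = {x, y}"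
    using xyz by auto
  have signs: "incidence_sign {y, z} x = (1::'k)" "incidence_sign {x, z} y = (- 1 :: 'k)"
    "incidence_sign {x, y} z = (1::'k)"
    unfolding incidence_sign_def below using xyz by simp_all
  have "(\<Sum>v\<in>T. incidence_sign (T - {v}) v * crossing d (T - {v}))
      = (\<Sum>v\<in>{x, y, z}. incidence_sign (T - {v}) v * crossing d (T - {v}) :: 'k)"
    using xyz(1) by simp
  also have "\<dots> = crossing d {y, z} - crossing d {x, z} + crossing d {x, y}"
    using xyz(2,3) by (simp add: diffs signs)
  also have "\<dots> = 0"
  proof -
    have "(y + d < z \<and> x + d < z \<and> y \<le> x + d) \<or> (x + d < y \<and> x + d < z \<and> z \<le> y + d)
      \<or> (y \<le> x + d \<and> z \<le> y + d \<and> z \<le> x + d)"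
      using xy yz xz
    proof (elim disjE)
    qed (use xyz(2,3) zn n in linarith)+
    then show ?thesis using xyz(2,3) by (elim disjE conjE) (simp_all add: crossing_pair)
  qed
  finally show ?thesis .
qed

lemma round_cycle_not_boundary:
  assumes n: "3 * d < n" and d: "1 \<le> d"
  shows "(round_cycle n :: nat set \<Rightarrow> 'k::field) \<notin> simplicial_boundaries (cyclic_cliques n d) 1"
proof
  let ?\<Delta> = "cyclic_cliques n d" and ?c = "round_cycle n :: nat set \<Rightarrow> 'k"
  assume "?c \<in> simplicial_boundaries ?\<Delta> 1"
  then obtain e where e: "e \<in> simplicial_chains ?\<Delta> 2" "?c = boundary ?\<Delta> e"
    unfolding simplicial_boundaries_def by auto
  have V: "finite {..<n}" "\<Union>?\<Delta> \<subseteq> {..<n}" by (auto simp: cyclic_cliques_def)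
  have "(\<Sum>E\<in>Pow {..<n}. crossing d E * ?c E) = 0"
    unfolding e(2)
    by (rule cocycle_annihilates_boundary[OF V e(1)]) (rule crossing_cocycle[OF n])
  moreover have "crossing d E * ?c E = (if E = {0, n - 1} then - 1 else 0)" for E
  proof (cases "\<exists>u. u + 1 < n \<and> E = {u, u + 1}")
    case True
    then obtain u where u: "E = {u, u + 1}" by blast
    then have "E \<noteq> {0, n - 1}" using n d by (auto simp: doubleton_eq_iff)
    moreover have "crossing d E = (0::'k)" using u d by (simp add: crossing_pair)
    ultimately show ?thesis by simp
  next
    case False
    have c: "?c E = (if E = {0, n - 1} then - 1 else 0)"
      unfolding round_cycle_def using False by (simp only: if_False)
    have "crossing d {0, n - 1} = (1::'k)" using n d by (simp add: crossing_pair)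
    then show ?thesis unfolding c by (cases "E = {0, n - 1}") (simp_all only: mult_1 mult_zero_right if_True if_False)
  qed
  moreover have "(\<Sum>E\<in>Pow {..<n}. if E = {0, n - 1} then - 1 else 0) = (- 1 :: 'k)"
    using n by simp
  ultimately show False by simp
qed

lemma not_cohen_macaulay_cyclic_cliques:
  assumes n: "3 * d < n" and d: "2 \<le> d"
  shows "\<not> cohen_macaulay TYPE('k::field) (cyclic_cliques n d)"
proof
  let ?\<Delta> = "cyclic_cliques n d"
  assume cm: "cohen_macaulay TYPE('k) ?\<Delta>"
  note sc = simplicial_complex_cyclic_cliques[of n d]
  have empty: "{} \<in> ?\<Delta>" by (simp add: cyclic_cliques_def)
  have link: "link ?\<Delta> {} = ?\<Delta>" by (simp add: link_def)
  have "finite ?\<Delta>" using sc unfolding simplicial_complex_def by blast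
  then have "face_dim (arc n d 0) \<le> complex_dim ?\<Delta>"
    unfolding complex_dim_def using arc_in_cyclic_cliques by (intro Max_ge) auto
  then have "1 < complex_dim ?\<Delta>" using card_arc[of d n 0] n d by (simp add: face_dim_def)
  then have "trivial_group (reduced_homology TYPE('k) ?\<Delta> 1)"
    using cm empty link unfolding cohen_macaulay_def by metis
  then show False
    using round_cycle_in_cycles[of d n, where 'k = 'k] round_cycle_not_boundary[OF n, where 'k = 'k] n d
    unfolding trivial_reduced_homology_iff[OF sc] by auto
qed

section \<open>The classification\<close>

theorem theorem3p3:
  fixes n d :: nat and G :: "nat graph" and \<Delta> :: "nat set set"
  assumes "n \<ge> 2 * d + 2" and "d \<ge> 1"
    and "G = circulant_graph n {d + 1..n div 2}"
    and "\<Delta> = independence_complex G"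
  shows "(buchsbaum TYPE('k::field) \<Delta> \<longleftrightarrow> well_covered G) \<and>
         (well_covered G \<longleftrightarrow> n > 3 * d \<or> n = 2 * d + 2) \<and>
         (vertex_decomposable \<Delta> \<longleftrightarrow> (n = 2 * d + 2 \<and> d \<ge> 1) \<or> (d = 1 \<and> n > 3)) \<and>
         (shellable \<Delta> \<longleftrightarrow> (n = 2 * d + 2 \<and> d \<ge> 1) \<or> (d = 1 \<and> n > 3)) \<and>
         (cohen_macaulay TYPE('k) \<Delta> \<longleftrightarrow> (n = 2 * d + 2 \<and> d \<ge> 1) \<or> (d = 1 \<and> n > 3))"
proof -
  have \<Delta>: "\<Delta> = cyclic_cliques n d" using assms(3,4) by (simp only: independence_complex_circulant)
  have "finite (fst G)" using assms(3) by (simp add: circulant_graph_def)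
  then have wc: "well_covered G \<longleftrightarrow> pure_complex \<Delta>"
    using well_covered_iff_pure edges_within_circulant_graph unfolding assms(3,4) by blast
  let ?P = "n > 3 * d \<or> n = 2 * d + 2" and ?Q = "(n = 2 * d + 2 \<and> d \<ge> 1) \<or> (d = 1 \<and> n > 3)"
  have pure_P: ?P if "pure_complex \<Delta>"
    using that cyclic_cliques_not_pure[of d n] assms(1) unfolding \<Delta> by linarith
  have Q_vd: "vertex_decomposable \<Delta>" if ?Q
  proof (cases "n = 2 * d + 2")
    case True
    then show ?thesis unfolding \<Delta> using vertex_decomposable_cyclic_cliques_matching[of d] by simp
  next
    case False
    then have "d = 1" "4 \<le> n" "3 * d < n" using that by auto
    then show ?thesis
      unfolding \<Delta> using vertex_decomposable_cyclic_cliques_cycle[of n] pure_cyclic_cliques[of 1 n] by simp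
  qed
  have cm_pure: "pure_complex \<Delta>" if "cohen_macaulay TYPE('k) \<Delta>"
    using that unfolding cohen_macaulay_def by blast
  have cm_Q: ?Q if cm: "cohen_macaulay TYPE('k) \<Delta>"
  proof (cases "n = 2 * d + 2")
    case False
    then have n: "3 * d < n" using pure_P[OF cm_pure[OF cm]] by blast
    then have "d = 1"
      using not_cohen_macaulay_cyclic_cliques[of d n, where 'k = 'k] cm assms(2) unfolding \<Delta> by linarith
    then show ?thesis using n by simp
  qed (use assms(2) in simp)
  have vd_cm: "cohen_macaulay TYPE('k) \<Delta>" if "vertex_decomposable \<Delta>"
    using that vertex_decomposable_imp_shellable shellable_imp_cohen_macaulay by blast
  have P_buchsbaum: "buchsbaum TYPE('k) \<Delta>" if P: ?P
  proof (cases "3 * d < n")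
    case True
    then show ?thesis unfolding \<Delta> by (rule buchsbaum_cyclic_cliques)
  next
    case False
    then have ?Q using P assms(2) by simp
    then show ?thesis using Q_vd vd_cm cohen_macaulay_imp_buchsbaum by blast
  qed
  have bb_pure: "pure_complex \<Delta>" if "buchsbaum TYPE('k) \<Delta>"
    using that unfolding buchsbaum_def by blast
  have "buchsbaum TYPE('k) \<Delta> \<longleftrightarrow> pure_complex \<Delta>" "pure_complex \<Delta> \<longleftrightarrow> ?P"
    using P_buchsbaum bb_pure pure_P by blast+
  moreover have "vertex_decomposable \<Delta> \<longleftrightarrow> ?Q" using Q_vd vd_cm cm_Q by blast
  moreover have "shellable \<Delta> \<longleftrightarrow> ?Q"
    using Q_vd vertex_decomposable_imp_shellable shellable_imp_cohen_macaulay[where 'k = 'k] cm_Q by blast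
  moreover have "cohen_macaulay TYPE('k) \<Delta> \<longleftrightarrow> ?Q" using Q_vd vd_cm cm_Q by blast
  ultimately show ?thesis using wc by blast
qed

end
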